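(* Let $\beta<1$. For each $n$, let $\sigma=(\sigma_1,\dots,\sigma_n)$ be a random element of $\{-1,1\}^n$ distributed according to the Curie–Weiss model with parameter $\beta$. Let $X_i=n^{-1/2}\sigma_i$, $i=1,\dots,n$, $X=(X_1,\dots,X_n)$, and let $Z\sim\mathrm{MVN}_n(0,\Sigma)$, where $\Sigma=(s_{ij})_{1\le i,j\le n}$ with $$s_{ij}=\begin{cases}\dfrac1n+\dfrac{\beta}{n^2(1-\beta)},&i=j,\\[2ex]\dfrac{\beta}{n^2(1-\beta)},&i\ne j.\end{cases}$$ Then there is a constant $C_\beta$ depending only on $\beta$ such that, for every $n$ and every three times partially differentiable function $h:\mathbb{R}^n\to\mathbb{R}$, $$|\mathbb{E}h(X)-\mathbb{E}h(Z)|\le C_\beta\left(\frac{|h|_1+|h|_3}{n^{1/2}}+\frac{|h|_2}{n}\right).$$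
   Context: Curie–Weiss model with parameter (inverse temperature) $\beta$: the probability measure on $\{-1,1\}^n$ given by $\mathbb{P}(\sigma)=e^{-\beta H(\sigma)}/Z(\beta)$, where $H(\sigma)=-\frac1n\sum_{i<j}\sigma_i\sigma_j$ and $Z(\beta)$ is the normalising constant. $\mathrm{MVN}_n(0,\Sigma)$ is the centred Gaussian law on $\mathbb{R}^n$ with covariance matrix $\Sigma$. For $k\ge1$, $|h|_k=\sup_{1\le i_1\le\dots\le i_k\le n}\|h_{i_1\dots i_k}\|_\infty$, where $h_{i_1\dots i_k}$ denotes the partial derivative of $h$ in the indicated coordinates and $\|\cdot\|_\infty$ is the supremum norm (infinite bounds are vacuous). "Three times partially differentiable" means that all partial derivatives up to order three exist (mixed partial derivatives being independent of the order of differentiation). *)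

theory Defs
  imports "HOL-Probability.Probability"
begin

text \<open>
  The dimension \<open>n\<close> is quantified inside the theorem, so \<open>\<real>\<^sup>n\<close> is modelled by the extensional
  functions \<open>{..<n} \<rightarrow>\<^sub>E UNIV\<close>, with coordinates numbered from \<open>0\<close>. A map \<open>h : \<real>\<^sup>n \<rightarrow> \<real>\<close> is a
  function on \<^typ>\<open>nat \<Rightarrow> real\<close>; everything below only uses its values on \<open>Rn n\<close>.
\<close>

abbreviation Rn :: "nat \<Rightarrow> (nat \<Rightarrow> real) set" where
  "Rn n \<equiv> {..<n} \<rightarrow>\<^sub>E UNIV"

abbreviation borel_Rn :: "nat \<Rightarrow> (nat \<Rightarrow> real) measure" where
  "borel_Rn n \<equiv> Pi\<^sub>M {..<n} (\<lambda>_. borel)"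


section \<open>Partial derivatives\<close>

definition partial_deriv :: "nat \<Rightarrow> ((nat \<Rightarrow> real) \<Rightarrow> real) \<Rightarrow> (nat \<Rightarrow> real) \<Rightarrow> real" where
  "partial_deriv i h x = deriv (\<lambda>t. h (x(i := t))) (x i)"

text \<open>\<open>iter_partial [i\<^sub>1, \<dots>, i\<^sub>k] h\<close> is \<open>h\<^sub>i\<^sub>1\<^sub>\<dots>\<^sub>i\<^sub>k\<close>, differentiating first in \<open>i\<^sub>k\<close> and last in \<open>i\<^sub>1\<close>.\<close>

definition iter_partial :: "nat list \<Rightarrow> ((nat \<Rightarrow> real) \<Rightarrow> real) \<Rightarrow> (nat \<Rightarrow> real) \<Rightarrow> real" where
  "iter_partial is h = foldr partial_deriv is h"

text \<open>
  No continuity of the derivatives is required. The first conjunct makes the values of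
  \<^const>\<open>deriv\<close> meaningful in all partial derivatives of order at most \<open>k\<close>.
\<close>

definition times_partially_differentiable ::
    "nat \<Rightarrow> nat \<Rightarrow> ((nat \<Rightarrow> real) \<Rightarrow> real) \<Rightarrow> bool" where
  "times_partially_differentiable k n h \<longleftrightarrow>
     (\<forall>is i x. length is < k \<and> set is \<subseteq> {..<n} \<and> i < n \<and> x \<in> Rn n \<longrightarrow>
        (\<lambda>t. iter_partial is h (x(i := t))) differentiable (at (x i))) \<and>
     (\<forall>is js x. length is \<le> k \<and> set is \<subseteq> {..<n} \<and> mset is = mset js \<and> x \<in> Rn n \<longrightarrow>
        iter_partial is h x = iter_partial js h x)"

definition partial_seminorm :: "nat \<Rightarrow> nat \<Rightarrow> ((nat \<Rightarrow> real) \<Rightarrow> real) \<Rightarrow> ennreal" where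
  "partial_seminorm n k h =
     (SUP is \<in> {is. length is = k \<and> sorted is \<and> set is \<subseteq> {..<n}}.
        SUP x \<in> Rn n. ennreal \<bar>iter_partial is h x\<bar>)"


section \<open>The Curie--Weiss model\<close>

definition spin_configs :: "nat \<Rightarrow> (nat \<Rightarrow> real) set" where
  "spin_configs n = {..<n} \<rightarrow>\<^sub>E {-1, 1}"

definition cw_hamiltonian :: "nat \<Rightarrow> (nat \<Rightarrow> real) \<Rightarrow> real" where
  "cw_hamiltonian n \<sigma> = - (1 / real n) * (\<Sum>j<n. \<Sum>i<j. \<sigma> i * \<sigma> j)"

definition cw_partition :: "real \<Rightarrow> nat \<Rightarrow> real" where
  "cw_partition \<beta> n = (\<Sum>\<sigma>\<in>spin_configs n. exp (- \<beta> * cw_hamiltonian n \<sigma>))"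

definition curie_weiss :: "real \<Rightarrow> nat \<Rightarrow> (nat \<Rightarrow> real) measure" where
  "curie_weiss \<beta> n = point_measure (spin_configs n)
     (\<lambda>\<sigma>. ennreal (exp (- \<beta> * cw_hamiltonian n \<sigma>) / cw_partition \<beta> n))"

definition rescale :: "nat \<Rightarrow> (nat \<Rightarrow> real) \<Rightarrow> (nat \<Rightarrow> real)" where
  "rescale n \<sigma> = (\<lambda>i\<in>{..<n}. \<sigma> i / sqrt (real n))"

definition cw_covariance :: "real \<Rightarrow> nat \<Rightarrow> nat \<Rightarrow> nat \<Rightarrow> real" where
  "cw_covariance \<beta> n i j =
     (if i = j then 1 / real n + \<beta> / ((real n)\<^sup>2 * (1 - \<beta>)) else \<beta> / ((real n)\<^sup>2 * (1 - \<beta>)))"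


section \<open>Centred Gaussian laws\<close>

definition std_normal_vector :: "nat \<Rightarrow> (nat \<Rightarrow> real) measure" where
  "std_normal_vector m = Pi\<^sub>M {..<m} (\<lambda>_. density lborel (\<lambda>x. ennreal (std_normal_density x)))"

text \<open>
  \<open>M\<close> is the law \<open>MVN\<^sub>n(0, \<Sigma>)\<close>: the law of \<open>A N\<close>, where \<open>N\<close> is a vector of \<open>m\<close> independent standard
  normal variables and \<open>A\<close> is an \<open>n \<times> m\<close> matrix with \<open>A A\<^sup>T = \<Sigma>\<close>. The law does not depend on
  the choice of \<open>m\<close> and \<open>A\<close>; singular \<open>\<Sigma>\<close> are covered.
\<close>

definition is_MVN :: "nat \<Rightarrow> (nat \<Rightarrow> nat \<Rightarrow> real) \<Rightarrow> (nat \<Rightarrow> real) measure \<Rightarrow> bool" where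
  "is_MVN n \<Sigma> M \<longleftrightarrow> (\<exists>m A.
     (\<forall>i<n. \<forall>j<n. \<Sigma> i j = (\<Sum>k<m. A i k * A j k)) \<and>
     M = distr (std_normal_vector m) (borel_Rn n) (\<lambda>x. \<lambda>i\<in>{..<n}. \<Sum>k<m. A i k * x k))"


section \<open>Sanity checks\<close>

lemma prob_space_curie_weiss: "prob_space (curie_weiss \<beta> n)"
proof -
  have fin: "finite (spin_configs n)"
    unfolding spin_configs_def by (intro finite_PiE) auto
  have ne: "spin_configs n \<noteq> {}"
    unfolding spin_configs_def by (simp add: PiE_eq_empty_iff)
  have pos: "cw_partition \<beta> n > 0"
    unfolding cw_partition_def by (intro sum_pos fin ne) auto
  have "(\<Sum>\<sigma>\<in>spin_configs n. exp (- \<beta> * cw_hamiltonian n \<sigma>) / cw_partition \<beta> n) = 1"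
    using pos by (simp add: sum_divide_distrib[symmetric] cw_partition_def)
  then have "(\<Sum>\<sigma>\<in>spin_configs n.
      ennreal (exp (- \<beta> * cw_hamiltonian n \<sigma>) / cw_partition \<beta> n)) = 1"
    using pos by (subst sum_ennreal) auto
  then show ?thesis
    unfolding curie_weiss_def by (intro prob_space_point_measure fin) auto
qed

lemma ex_MVN_cw_covariance:
  assumes "\<beta> < 1" "n > 0"
  shows "\<exists>M. is_MVN n (cw_covariance \<beta> n) M"
proof -
  define a where "a = 1 / sqrt (real n)"
  define c where "c = \<beta> / ((real n)\<^sup>2 * (1 - \<beta>))"
  define s where "s = sqrt (1 / (real n * (1 - \<beta>)))"
  define b where "b = (s - a) / real n"
  define A where "A = (\<lambda>i k :: nat. (if i = k then a else 0) + b)"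
  have a2: "a * a = 1 / real n"
    using assms by (simp add: a_def field_simps)
  have s2: "s * s = 1 / (real n * (1 - \<beta>))"
    using assms by (simp add: s_def)
  have nb: "real n * b = s - a"
    using assms by (simp add: b_def)
  have "real n * (2 * a * b + real n * b * b) = 2 * a * (real n * b) + (real n * b) * (real n * b)"
    by (simp add: algebra_simps)
  also have "\<dots> = s * s - a * a"
    unfolding nb by (simp add: algebra_simps)
  also have "\<dots> = real n * c"
    unfolding a2 s2 c_def using assms by (simp add: divide_simps power2_eq_square)
  finally have c: "2 * a * b + real n * b * b = c"
    using assms by simp
  have "cw_covariance \<beta> n i j = (\<Sum>k<n. A i k * A j k)" if "i < n" "j < n" for i j
  proof -
    have "(\<Sum>k<n. A i k * A j k) =
        (\<Sum>k<n. (if k = i then (if i = j then a * a else 0) else 0)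
           + ((if k = i then a * b else 0) + (if k = j then a * b else 0)) + b * b)"
      by (intro sum.cong) (auto simp: A_def algebra_simps)
    also have "\<dots> = (if i = j then a * a else 0) + (2 * a * b + real n * b * b)"
      using that by (simp add: sum.distrib)
    also have "\<dots> = cw_covariance \<beta> n i j"
      unfolding c a2 by (simp add: cw_covariance_def c_def)
    finally show ?thesis by simp
  qed
  then show ?thesis
    unfolding is_MVN_def by blast
qed

end

theory Submission
  imports Defs
begin

text \<open>
  Rotate from \<open>X\<close> to an independent \<open>Z\<close> along \<open>Y\<^sub>t = cos t X + sin t Z\<close>, \<open>0 \<le> t \<le> \<pi>/2\<close>, and bound the
  derivative of \<open>E h(Y\<^sub>t)\<close>. Gaussian integration by parts gives \<open>E Z\<^sub>i h\<^sub>i(Y\<^sub>t) = sin t \<Sum>\<^sub>j s\<^sub>i\<^sub>j E h\<^sub>i\<^sub>j(Y\<^sub>t)\<close>.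
  For the spins, conditioning on all coordinates but one gives
  \<open>E \<sigma>\<^sub>j f = E tanh(\<beta> m\<^sub>j) f + E (1 - tanh\<^sup>2(\<beta> m\<^sub>j)) \<Delta>\<^sub>j f\<close>. Linearising \<open>tanh\<close>, which costs only the second
  moment of the magnetisation, and summing over \<open>j\<close> solves for \<open>E (\<Sum>\<^sub>j \<sigma>\<^sub>j) f\<close>; this yields
  \<open>E X\<^sub>i h\<^sub>i(Y\<^sub>t) = cos t \<Sum>\<^sub>j s\<^sub>i\<^sub>j E h\<^sub>i\<^sub>j(Y\<^sub>t)\<close> up to a small error with exactly the matrix \<open>\<Sigma>\<close>, so that in
  the derivative the main terms cancel.
\<close>

section \<open>Functions with bounded partial derivatives\<close>

text \<open>The derivatives of \<open>h\<close> exist along coordinate axes and need not be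
  continuous, so neither a chain rule nor integration by parts is available at the outset. Finite
  seminorms repair this: a bound on the partial derivatives of a function makes it Lipschitz for the
  l1 distance with the same constant. Bounded third derivatives thus make the second ones Lipschitz,
  and \<open>h\<close> and its first derivatives become totally differentiable. Each norm has its
  own source. |h|_1 multiplies the error of replacing tanh by its argument and the local field by
  the full mean magnetisation; |h|_2 multiplies the tanh^2 correction to a discrete derivative of
  size n^(-1/2); |h|_3 multiplies the gap between the discrete and the true derivative. The error
  per coordinate is of order (|h|_1 + |h|_3) / n + |h|_2 / n^(3/2), and summing n coordinates, each
  with the factor n^(-1/2) of X, gives the stated rates. The trigonometric path keeps the
  coefficients of X and Z in its velocity bounded, so the ends of the path cause no
  singularity.\<close>

definition depends_on_first :: "nat \<Rightarrow> ((nat \<Rightarrow> real) \<Rightarrow> real) \<Rightarrow> bool" where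
  "depends_on_first n F \<longleftrightarrow> (\<forall>x y. (\<forall>i<n. x i = y i) \<longrightarrow> F x = F y)"

text \<open>The derivatives are carried as an explicit family \<open>G\<close> at every point of
  \<open>nat \<Rightarrow> real\<close>; one coordinate varies at a time and nothing is claimed
  about joint differentiability.\<close>

definition has_partials ::
    "nat \<Rightarrow> ((nat \<Rightarrow> real) \<Rightarrow> real) \<Rightarrow> (nat \<Rightarrow> (nat \<Rightarrow> real) \<Rightarrow> real) \<Rightarrow> bool" where
  "has_partials n F G \<longleftrightarrow>
     (\<forall>x. \<forall>i<n. ((\<lambda>s. F (x(i := s))) has_real_derivative G i x) (at (x i)))"

definition l1_dist :: "nat \<Rightarrow> (nat \<Rightarrow> real) \<Rightarrow> (nat \<Rightarrow> real) \<Rightarrow> real" where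
  "l1_dist n x y = (\<Sum>i<n. \<bar>x i - y i\<bar>)"

text \<open>The l1 distance is dual to the supremum over coordinates in the seminorms: a bound
  \<open>L\<close> on all partial derivatives gives the constant \<open>L\<close> itself, with no
  factor depending on \<open>n\<close>.\<close>

definition l1_lipschitz :: "nat \<Rightarrow> real \<Rightarrow> ((nat \<Rightarrow> real) \<Rightarrow> real) \<Rightarrow> bool" where
  "l1_lipschitz n L F \<longleftrightarrow> (\<forall>x y. \<bar>F x - F y\<bar> \<le> L * l1_dist n x y)"

lemma l1_dist_fun_upd: "i < n \<Longrightarrow> l1_dist n (x(i := s)) (x(i := t)) = \<bar>s - t\<bar>"
proof -
  assume "i < n"
  have "l1_dist n (x(i := s)) (x(i := t)) = (\<Sum>k<n. if k = i then \<bar>s - t\<bar> else 0)"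
    unfolding l1_dist_def by (intro sum.cong) auto
  then show ?thesis using \<open>i < n\<close> by simp
qed

lemma l1_lipschitzD: "l1_lipschitz n L F \<Longrightarrow> \<bar>F x - F y\<bar> \<le> L * l1_dist n x y"
  unfolding l1_lipschitz_def by blast

lemma l1_lipschitz_depends: "l1_lipschitz n L F \<Longrightarrow> depends_on_first n F"
  unfolding depends_on_first_def
proof (intro allI impI)
  fix x y :: "nat \<Rightarrow> real" assume L: "l1_lipschitz n L F" and e: "\<forall>i<n. x i = y i"
  have "l1_dist n x y = 0" using e by (simp add: l1_dist_def)
  with l1_lipschitzD[OF L, of x y] show "F x = F y" by simp
qed

lemma has_partialsD:
  assumes "has_partials n F G" "i < n"
  shows "((\<lambda>s. F (x(i := s))) has_real_derivative G i (x(i := t))) (at t)"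
proof -
  have "((\<lambda>s. F ((x(i := t))(i := s))) has_real_derivative G i (x(i := t))) (at ((x(i := t)) i))"
    using assms unfolding has_partials_def by blast
  then show ?thesis by simp
qed

text \<open>Both distances of the intermediate point are recorded and \<open>u\<close>,
  \<open>v\<close> come in either order, since a base point may later be either end of the
  interval.\<close>

lemma mvt_any_order:
  fixes f :: "real \<Rightarrow> real"
  assumes "\<And>t. (f has_real_derivative f' t) (at t)"
  obtains \<xi> where "f v - f u = f' \<xi> * (v - u)" "\<bar>\<xi> - u\<bar> \<le> \<bar>v - u\<bar>" "\<bar>\<xi> - v\<bar> \<le> \<bar>v - u\<bar>"
proof -
  consider "u = v" | "u < v" | "v < u" by linarith
  then show thesis
  proof cases
    case 1
    show ?thesis by (rule that[of u]) (auto simp: 1)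
  next
    case 2
    from MVT2[OF 2, of f f'] assms obtain z where "u < z" "z < v" "f v - f u = (v - u) * f' z"
      by auto
    then show ?thesis by (intro that[of z]) auto
  next
    case 3
    from MVT2[OF 3, of f f'] assms obtain z where "v < z" "z < u" "f u - f v = (u - v) * f' z"
      by auto
    then show ?thesis by (intro that[of z]) (auto simp: algebra_simps)
  qed
qed

lemma partial_mvt:
  assumes "has_partials n F G" "i < n"
  obtains \<xi> where "F (x(i := v)) - F (x(i := u)) = G i (x(i := \<xi>)) * (v - u)"
    "\<bar>\<xi> - u\<bar> \<le> \<bar>v - u\<bar>" "\<bar>\<xi> - v\<bar> \<le> \<bar>v - u\<bar>"
proof -
  obtain \<xi> where "F (x(i := v)) - F (x(i := u)) = G i (x(i := \<xi>)) * (v - u)"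
    "\<bar>\<xi> - u\<bar> \<le> \<bar>v - u\<bar>" "\<bar>\<xi> - v\<bar> \<le> \<bar>v - u\<bar>"
    using mvt_any_order[OF has_partialsD[OF assms], of x v u] by blast
  then show thesis by (rule that)
qed

text \<open>Points are joined by changing one coordinate at a time, so that only partial derivatives
  are needed.\<close>

lemma hybrid_path:
  assumes "depends_on_first n F" "has_partials n F G"
  obtains \<xi> where "F x - F y = (\<Sum>i<n. G i (\<xi> i) * (x i - y i))"
    "\<And>i. i < n \<Longrightarrow> l1_dist n (\<xi> i) y \<le> l1_dist n x y"
proof -
  define z where "z k = (\<lambda>i. if i < k then x i else y i)" for k :: nat
  have "\<exists>\<zeta>. F (z (Suc k)) - F (z k) = G k \<zeta> * (x k - y k) \<and> l1_dist n \<zeta> y \<le> l1_dist n x y"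
    if k: "k < n" for k
  proof -
    obtain t where t: "F ((z k)(k := x k)) - F ((z k)(k := y k)) = G k ((z k)(k := t)) * (x k - y k)"
      "\<bar>t - y k\<bar> \<le> \<bar>x k - y k\<bar>"
      by (rule partial_mvt[OF assms(2) k])
    have "(z k)(k := x k) = z (Suc k)" "(z k)(k := y k) = z k"
      by (auto simp: z_def)
    moreover have "l1_dist n ((z k)(k := t)) y \<le> l1_dist n x y"
      unfolding l1_dist_def using t(2) by (intro sum_mono) (auto simp: z_def)
    ultimately show ?thesis using t(1) by (intro exI[of _ "(z k)(k := t)"]) auto
  qed
  then obtain \<xi> where \<xi>: "\<And>k. k < n \<Longrightarrow> F (z (Suc k)) - F (z k) = G k (\<xi> k) * (x k - y k)"
    "\<And>k. k < n \<Longrightarrow> l1_dist n (\<xi> k) y \<le> l1_dist n x y"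
    by metis
  have "F x = F (z n)" using assms(1) unfolding depends_on_first_def by (simp add: z_def)
  moreover have "F y = F (z 0)" by (simp add: z_def)
  moreover have "F (z n) - F (z 0) = (\<Sum>k<n. G k (\<xi> k) * (x k - y k))"
    unfolding sum_lessThan_telescope[of "\<lambda>k. F (z k)" n, symmetric]
    by (intro sum.cong) (auto simp: \<xi>(1))
  ultimately show thesis using \<xi>(2) by (intro that[of \<xi>]) auto
qed

section \<open>Lipschitz bounds, total differentiability and measurability\<close>

lemma l1_lipschitz_if_partials_bounded:
  assumes "depends_on_first n F" "has_partials n F G" "\<And>i x. i < n \<Longrightarrow> \<bar>G i x\<bar> \<le> L"
  shows "l1_lipschitz n L F"
  unfolding l1_lipschitz_def
proof (intro allI)
  fix x y
  obtain \<xi> where \<xi>: "F x - F y = (\<Sum>i<n. G i (\<xi> i) * (x i - y i))"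
    using hybrid_path[OF assms(1,2), of x y] by blast
  have "\<bar>F x - F y\<bar> \<le> (\<Sum>i<n. \<bar>G i (\<xi> i) * (x i - y i)\<bar>)"
    unfolding \<xi> by (rule sum_abs)
  also have "\<dots> \<le> (\<Sum>i<n. L * \<bar>x i - y i\<bar>)"
    unfolding abs_mult using assms(3) by (intro sum_mono mult_right_mono) auto
  finally show "\<bar>F x - F y\<bar> \<le> L * l1_dist n x y"
    by (simp add: l1_dist_def sum_distrib_left)
qed

text \<open>Along the coordinate path each derivative is evaluated no further from \<open>y\<close>
  than \<open>x\<close> is, so it differs from its value at \<open>y\<close> by at most
  \<open>L\<close> times the distance. The quadratic remainder amounts to total
  differentiability.\<close>

lemma first_order_remainder:
  assumes "depends_on_first n F" "has_partials n F G" "\<And>i. i < n \<Longrightarrow> l1_lipschitz n L (G i)" "L \<ge> 0"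
  shows "\<bar>F x - F y - (\<Sum>i<n. G i y * (x i - y i))\<bar> \<le> L * (l1_dist n x y)\<^sup>2"
proof -
  obtain \<xi> where \<xi>: "F x - F y = (\<Sum>i<n. G i (\<xi> i) * (x i - y i))"
    "\<And>i. i < n \<Longrightarrow> l1_dist n (\<xi> i) y \<le> l1_dist n x y"
    using hybrid_path[OF assms(1,2), of x y] by blast
  have "F x - F y - (\<Sum>i<n. G i y * (x i - y i)) = (\<Sum>i<n. (G i (\<xi> i) - G i y) * (x i - y i))"
    unfolding \<xi>(1) by (simp add: sum_subtractf[symmetric] algebra_simps)
  also have "\<bar>\<dots>\<bar> \<le> (\<Sum>i<n. \<bar>(G i (\<xi> i) - G i y) * (x i - y i)\<bar>)"
    by (rule sum_abs)
  also have "\<dots> \<le> (\<Sum>i<n. L * l1_dist n x y * \<bar>x i - y i\<bar>)"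
    unfolding abs_mult
  proof (intro sum_mono mult_right_mono)
    fix i assume i: "i \<in> {..<n}"
    have "\<bar>G i (\<xi> i) - G i y\<bar> \<le> L * l1_dist n (\<xi> i) y"
      using assms(3) i by (intro l1_lipschitzD) auto
    also have "\<dots> \<le> L * l1_dist n x y"
      using \<xi>(2) i assms(4) by (intro mult_left_mono) auto
    finally show "\<bar>G i (\<xi> i) - G i y\<bar> \<le> L * l1_dist n x y" .
  qed auto
  also have "\<dots> = L * l1_dist n x y * l1_dist n x y"
    by (simp add: l1_dist_def sum_distrib_left)
  finally show ?thesis by (simp add: power2_eq_square mult_ac)
qed

text \<open>The quadratic remainder divided by \<open>s - t\<close> is a squared sum of difference
  quotients, which stays bounded, times \<open>\<bar>s - t\<bar>\<close>, so it vanishes in the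
  limit. This chain rule serves both the rotation and linear images of normal vectors.\<close>

lemma has_real_derivative_along_curve:
  assumes "depends_on_first n F" "has_partials n F G" "\<And>i. i < n \<Longrightarrow> l1_lipschitz n L (G i)" "L \<ge> 0"
    and y: "\<And>i. i < n \<Longrightarrow> ((\<lambda>s. y s i) has_real_derivative y' i) (at t)"
  shows "((\<lambda>s. F (y s)) has_real_derivative (\<Sum>i<n. G i (y t) * y' i)) (at t)"
proof -
  have quot: "((\<lambda>s. (y s i - y t i) / (s - t)) \<longlongrightarrow> y' i) (at t)" if "i < n" for i
    using y[OF that] by (simp add: has_field_derivative_iff)
  have 0: "((\<lambda>s. L * (\<Sum>i<n. \<bar>(y s i - y t i) / (s - t)\<bar>)\<^sup>2 * \<bar>s - t\<bar>) \<longlongrightarrow>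
      L * (\<Sum>i<n. \<bar>y' i\<bar>)\<^sup>2 * \<bar>t - t\<bar>) (at t)"
    by (intro tendsto_intros quot) auto
  have "((\<lambda>s. (F (y s) - F (y t)) / (s - t) - (\<Sum>i<n. G i (y t) * ((y s i - y t i) / (s - t))))
      \<longlongrightarrow> 0) (at t)"
  proof (rule Lim_null_comparison)
    show "\<forall>\<^sub>F s in at t. norm ((F (y s) - F (y t)) / (s - t)
        - (\<Sum>i<n. G i (y t) * ((y s i - y t i) / (s - t))))
        \<le> L * (\<Sum>i<n. \<bar>(y s i - y t i) / (s - t)\<bar>)\<^sup>2 * \<bar>s - t\<bar>"
      unfolding eventually_at_filter
    proof (intro always_eventually allI impI)
      fix s assume s: "s \<noteq> t"
      have "(F (y s) - F (y t)) / (s - t) - (\<Sum>i<n. G i (y t) * ((y s i - y t i) / (s - t)))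
          = (F (y s) - F (y t) - (\<Sum>i<n. G i (y t) * (y s i - y t i))) / (s - t)"
        by (simp add: diff_divide_distrib[of "F (y s) - F (y t)"] sum_divide_distrib)
      also have "norm \<dots> \<le> L * (l1_dist n (y s) (y t))\<^sup>2 / \<bar>s - t\<bar>"
        unfolding real_norm_def abs_divide
        by (intro divide_right_mono first_order_remainder[OF assms(1-4)]) auto
      also have "\<dots> = L * (\<Sum>i<n. \<bar>(y s i - y t i) / (s - t)\<bar>)\<^sup>2 * \<bar>s - t\<bar>"
        using s by (simp add: l1_dist_def sum_divide_distrib[symmetric] abs_divide power_divide)
          (simp add: power2_eq_square abs_mult_self_eq[symmetric, of "s - t"] del: abs_mult_self_eq)
      finally show "norm ((F (y s) - F (y t)) / (s - t)
        - (\<Sum>i<n. G i (y t) * ((y s i - y t i) / (s - t))))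
        \<le> L * (\<Sum>i<n. \<bar>(y s i - y t i) / (s - t)\<bar>)\<^sup>2 * \<bar>s - t\<bar>" .
    qed
    show "((\<lambda>s. L * (\<Sum>i<n. \<bar>(y s i - y t i) / (s - t)\<bar>)\<^sup>2 * \<bar>s - t\<bar>) \<longlongrightarrow> 0) (at t)"
      using 0 by simp
  qed
  moreover have "((\<lambda>s. \<Sum>i<n. G i (y t) * ((y s i - y t i) / (s - t)))
      \<longlongrightarrow> (\<Sum>i<n. G i (y t) * y' i)) (at t)"
    by (intro tendsto_intros quot) auto
  ultimately have "((\<lambda>s. ((F (y s) - F (y t)) / (s - t)
        - (\<Sum>i<n. G i (y t) * ((y s i - y t i) / (s - t))))
        + (\<Sum>i<n. G i (y t) * ((y s i - y t i) / (s - t))))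
      \<longlongrightarrow> 0 + (\<Sum>i<n. G i (y t) * y' i)) (at t)"
    by (rule tendsto_add)
  then show ?thesis by (simp add: has_field_derivative_iff)
qed

text \<open>Finitely many coordinates enter the distance, so the function is continuous for the
  product topology on all of \<open>nat \<Rightarrow> real\<close>, where the Borel and the product
  sigma-algebra agree.\<close>

lemma l1_lipschitz_measurable:
  assumes "l1_lipschitz n L F"
  shows "F \<in> borel_measurable (borel_Rn n)"
proof -
  have dep: "depends_on_first n F" by (rule l1_lipschitz_depends[OF assms])
  have "continuous_on UNIV F"
  proof (rule continuous_at_imp_continuous_on, rule ballI)
    fix x :: "nat \<Rightarrow> real"
    have cont: "((\<lambda>y. y i) \<longlongrightarrow> x i) (at x)" for i
      using continuous_on_product_coordinates[of i, where 'b=real]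
      by (simp add: continuous_on_def)
    have "((\<lambda>y. L * l1_dist n y x) \<longlongrightarrow> L * (\<Sum>i<n. \<bar>x i - x i\<bar>)) (at x)"
      unfolding l1_dist_def by (intro tendsto_intros cont)
    then have "((\<lambda>y. L * l1_dist n y x) \<longlongrightarrow> 0) (at x)" by simp
    then have "((\<lambda>y. F y - F x) \<longlongrightarrow> 0) (at x)"
      by (rule Lim_null_comparison[rotated]) (use l1_lipschitzD[OF assms] in auto)
    then show "isCont F x"
      by (simp add: isCont_def LIM_zero_iff)
  qed
  then have F: "F \<in> borel_measurable (Pi\<^sub>M UNIV (\<lambda>_. borel))"
    using borel_measurable_continuous_onI sets_PiM_equal_borel measurable_cong_sets by blast
  \<comment> \<open>Padding with zeros carries the result from the infinite product back to
    \<open>borel_Rn n\<close>, whose points are \<open>undefined\<close> outside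
    \<open>{..<n}\<close>.\<close>
  define e where "e x = (\<lambda>i. if i < n then x i else 0)" for x :: "nat \<Rightarrow> real"
  have "e \<in> measurable (borel_Rn n) (Pi\<^sub>M UNIV (\<lambda>_. borel))"
    unfolding e_def
  proof (rule measurable_PiM_single')
    fix i :: nat
    show "(\<lambda>x. if i < n then x i else 0) \<in> borel_measurable (borel_Rn n)"
      by (cases "i < n") (auto intro: measurable_component_singleton)
  qed auto
  from measurable_compose[OF this F] have "(\<lambda>x. F (e x)) \<in> borel_measurable (borel_Rn n)" .
  moreover have "F (e x) = F x" for x
    using dep unfolding depends_on_first_def e_def by simp
  ultimately show ?thesis by simp
qed

section \<open>Spin identities for the Curie--Weiss model\<close>

lemma has_real_derivative_tanh: "(tanh has_real_derivative 1 - (tanh t)\<^sup>2) (at t)"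
  by (auto intro!: derivative_eq_intros)

lemma abs_tanh_le: "\<bar>tanh x\<bar> \<le> \<bar>x::real\<bar>"
proof -
  obtain \<xi> where "tanh x - tanh 0 = (1 - (tanh \<xi>)\<^sup>2) * (x - 0)"
    using mvt_any_order[OF has_real_derivative_tanh, of x 0] by blast
  moreover have "\<bar>1 - (tanh \<xi>)\<^sup>2\<bar> \<le> 1"
    using tanh_real_bounds[of \<xi>] by (auto simp: abs_le_iff abs_square_le_1 abs_square_less_1 less_imp_le)
  ultimately show ?thesis using mult_right_mono[of "\<bar>1 - (tanh \<xi>)\<^sup>2\<bar>" 1 "\<bar>x\<bar>"]
    by (simp add: abs_mult)
qed

lemma tanh_sq_le: "(tanh x)\<^sup>2 \<le> (x::real)\<^sup>2"
  using abs_tanh_le[of x] by (simp add: abs_le_square_iff)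

lemma abs_tanh_le_1: "\<bar>tanh (x::real)\<bar> \<le> 1"
  using tanh_real_bounds[of x] by auto

text \<open>One factor of tanh^2 is bounded by 1 to get a quadratic instead of a cubic bound: its
  mean then requires just the second moment of the local field.\<close>

lemma abs_tanh_diff_le: "\<bar>tanh x - x\<bar> \<le> (x::real)\<^sup>2"
proof -
  obtain \<xi> where \<xi>: "tanh x - tanh 0 = (1 - (tanh \<xi>)\<^sup>2) * (x - 0)" "\<bar>\<xi> - 0\<bar> \<le> \<bar>x - 0\<bar>"
    using mvt_any_order[OF has_real_derivative_tanh, of x 0] by blast
  have "tanh x - x = - (tanh \<xi> * tanh \<xi> * x)"
    using \<xi>(1) by (simp add: algebra_simps power2_eq_square)
  then have "\<bar>tanh x - x\<bar> = \<bar>tanh \<xi>\<bar> * \<bar>tanh \<xi>\<bar> * \<bar>x\<bar>"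
    by (simp only: abs_minus_cancel abs_mult)
  also have "\<dots> \<le> 1 * \<bar>\<xi>\<bar> * \<bar>x\<bar>"
    using abs_tanh_le_1[of \<xi>] abs_tanh_le[of \<xi>] by (intro mult_right_mono mult_mono) auto
  also have "\<dots> \<le> \<bar>x\<bar> * \<bar>x\<bar>"
    using \<xi>(2) mult_right_mono[of "\<bar>\<xi>\<bar>" "\<bar>x\<bar>" "\<bar>x\<bar>"] by simp
  also have "\<dots> = x\<^sup>2" by (simp add: power2_eq_square)
  finally show ?thesis .
qed

text \<open>For negative \<open>\<beta>\<close> the product is never positive, so an
  antiferromagnetic interaction contributes nothing. For \<open>\<beta> < 1\<close> the factor
  \<open>max \<beta> 0\<close> lies in \<open>[0, 1)\<close> and can be absorbed in the second
  moment bound.\<close>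

lemma mult_tanh_le: "x * tanh (\<beta> * x) \<le> max \<beta> 0 * (x::real)\<^sup>2"
proof (cases "\<beta> \<ge> 0")
  case True
  have "x * tanh (\<beta> * x) \<le> \<bar>x\<bar> * \<bar>tanh (\<beta> * x)\<bar>" by (metis abs_ge_self abs_mult)
  also have "\<dots> \<le> \<bar>x\<bar> * \<bar>\<beta> * x\<bar>" by (intro mult_left_mono abs_tanh_le) auto
  finally show ?thesis using True by (simp add: abs_mult power2_eq_square mult_ac)
next
  case False
  then have "x * tanh (\<beta> * x) \<le> 0"
    by (cases "x \<ge> 0") (auto simp: mult_le_0_iff zero_le_mult_iff)
  then show ?thesis using False by simp
qed

section \<open>Curie--Weiss expectations as finite weighted sums\<close>

definition cw_mean :: "real \<Rightarrow> nat \<Rightarrow> ((nat \<Rightarrow> real) \<Rightarrow> real) \<Rightarrow> real" where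
  "cw_mean \<beta> n f =
     (\<Sum>\<sigma>\<in>spin_configs n. exp (- \<beta> * cw_hamiltonian n \<sigma>) / cw_partition \<beta> n * f \<sigma>)"

text \<open>The mean field exerted on spin \<open>j\<close> by the others; it is independent of
  \<open>\<sigma> j\<close>, hence the natural parameter of the conditional law of that
  spin.\<close>

definition local_field :: "nat \<Rightarrow> nat \<Rightarrow> (nat \<Rightarrow> real) \<Rightarrow> real" where
  "local_field n j \<sigma> = ((\<Sum>k<n. \<sigma> k) - \<sigma> j) / real n"

lemma finite_spin_configs: "finite (spin_configs n)"
  unfolding spin_configs_def by (intro finite_PiE) auto

lemma cw_partition_pos: "cw_partition \<beta> n > 0"
  unfolding cw_partition_def
  by (intro sum_pos finite_spin_configs) (auto simp: spin_configs_def PiE_eq_empty_iff)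

lemma integral_curie_weiss: "(\<integral>\<sigma>. f \<sigma> \<partial>curie_weiss \<beta> n) = cw_mean \<beta> n f"
proof -
  have "0 \<le> exp (- \<beta> * cw_hamiltonian n \<sigma>) / cw_partition \<beta> n" for \<sigma>
    using cw_partition_pos[of \<beta> n] by (intro divide_nonneg_pos) auto
  then show ?thesis
    unfolding curie_weiss_def cw_mean_def
    by (subst lebesgue_integral_point_measure_finite) (auto simp: finite_spin_configs)
qed

lemma cw_mean_const [simp]: "cw_mean \<beta> n (\<lambda>_. c) = c"
  using cw_partition_pos[of \<beta> n]
  by (simp add: cw_mean_def sum_distrib_right[symmetric] sum_divide_distrib[symmetric] cw_partition_def)

lemma cw_mean_add: "cw_mean \<beta> n (\<lambda>\<sigma>. f \<sigma> + g \<sigma>) = cw_mean \<beta> n f + cw_mean \<beta> n g"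
  by (simp add: cw_mean_def sum.distrib distrib_left)

lemma cw_mean_diff: "cw_mean \<beta> n (\<lambda>\<sigma>. f \<sigma> - g \<sigma>) = cw_mean \<beta> n f - cw_mean \<beta> n g"
  by (simp add: cw_mean_def sum_subtractf right_diff_distrib)

lemma cw_mean_cmult: "cw_mean \<beta> n (\<lambda>\<sigma>. c * f \<sigma>) = c * cw_mean \<beta> n f"
  by (simp add: cw_mean_def sum_distrib_left mult_ac)

lemma cw_mean_sum: "cw_mean \<beta> n (\<lambda>\<sigma>. \<Sum>i\<in>I. f i \<sigma>) = (\<Sum>i\<in>I. cw_mean \<beta> n (f i))"
  unfolding cw_mean_def sum_distrib_left by (rule sum.swap)

lemma cw_mean_mono:
  assumes "\<And>\<sigma>. \<sigma> \<in> spin_configs n \<Longrightarrow> f \<sigma> \<le> g \<sigma>"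
  shows "cw_mean \<beta> n f \<le> cw_mean \<beta> n g"
  unfolding cw_mean_def
  using cw_partition_pos[of \<beta> n] assms by (intro sum_mono mult_left_mono) auto

lemma cw_mean_abs_le:
  assumes "\<And>\<sigma>. \<sigma> \<in> spin_configs n \<Longrightarrow> \<bar>f \<sigma>\<bar> \<le> g \<sigma>"
  shows "\<bar>cw_mean \<beta> n f\<bar> \<le> cw_mean \<beta> n g"
proof -
  have "cw_mean \<beta> n f \<le> cw_mean \<beta> n g"
    by (rule cw_mean_mono) (use assms abs_le_D1 in blast)
  moreover have "cw_mean \<beta> n (\<lambda>\<sigma>. -1 * f \<sigma>) \<le> cw_mean \<beta> n g"
    by (rule cw_mean_mono) (use assms abs_le_D2 in auto)
  ultimately show ?thesis
    unfolding cw_mean_cmult by simp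
qed

section \<open>The weight of a configuration as a function of one spin\<close>

lemma spin_cases: "\<sigma> \<in> spin_configs n \<Longrightarrow> i < n \<Longrightarrow> \<sigma> i = 1 \<or> \<sigma> i = -1"
  unfolding spin_configs_def by auto

lemma spin_sq: "\<sigma> \<in> spin_configs n \<Longrightarrow> i < n \<Longrightarrow> \<sigma> i * \<sigma> i = 1"
  using spin_cases[of \<sigma> n i] by auto

lemma pair_sum_eq:
  fixes \<sigma> :: "nat \<Rightarrow> real"
  shows "2 * (\<Sum>j<n. \<Sum>i<j. \<sigma> i * \<sigma> j) = (\<Sum>i<n. \<sigma> i)\<^sup>2 - (\<Sum>i<n. \<sigma> i * \<sigma> i)"
proof (induction n)
  case (Suc n)
  have "(\<Sum>i<n. \<sigma> i * \<sigma> n) = (\<Sum>i<n. \<sigma> i) * \<sigma> n" by (simp add: sum_distrib_right)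
  with Suc show ?case
    by (simp only: sum.lessThan_Suc distrib_left power2_sum) (simp add: power2_eq_square)
qed simp

lemma cw_hamiltonian_eq:
  assumes "\<sigma> \<in> spin_configs n" "n > 0"
  shows "- \<beta> * cw_hamiltonian n \<sigma> = \<beta> / (2 * real n) * (\<Sum>i<n. \<sigma> i)\<^sup>2 - \<beta> / 2"
proof -
  have "(\<Sum>i<n. \<sigma> i * \<sigma> i) = real n" using spin_sq[OF assms(1)] by simp
  with pair_sum_eq[of \<sigma> n]
  have pairs: "(\<Sum>j<n. \<Sum>i<j. \<sigma> i * \<sigma> j) = ((\<Sum>i<n. \<sigma> i)\<^sup>2 - real n) / 2" by simp
  show ?thesis
    unfolding cw_hamiltonian_def pairs using assms(2) by (simp add: field_simps)
qed

lemma sum_upd_eq: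
  fixes \<sigma> :: "nat \<Rightarrow> real"
  assumes "j < n"
  shows "(\<Sum>k<n. (\<sigma>(j := t)) k) = (\<Sum>k<n. \<sigma> k) - \<sigma> j + t"
proof -
  have "(\<Sum>k<n. (\<sigma>(j := t)) k - \<sigma> k) = (\<Sum>k<n. if k = j then t - \<sigma> j else 0)"
    by (intro sum.cong) auto
  also have "\<dots> = t - \<sigma> j" using assms by simp
  finally show ?thesis by (simp add: sum_subtractf del: fun_upd_apply)
qed

text \<open>Writing the total spin as \<open>n m + \<sigma>\<^sub>j\<close> and using
  \<open>\<sigma>\<^sub>j\<^sup>2 = 1\<close>, the part of the exponent that still contains spin
  \<open>j\<close> is linear in it. Its two values thus carry the weights
  \<open>exp (\<beta> m)\<close> and \<open>exp (- \<beta> m)\<close> up to a common factor.\<close>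

lemma cw_weight_split:
  assumes "\<sigma> \<in> spin_configs n" "j < n"
  shows "exp (- \<beta> * cw_hamiltonian n \<sigma>) =
    exp (\<beta> * real n / 2 * (local_field n j \<sigma>)\<^sup>2 + \<beta> / (2 * real n) - \<beta> / 2)
    * exp (\<beta> * local_field n j \<sigma> * \<sigma> j)"
proof -
  define m where "m = local_field n j \<sigma>"
  have n: "real n > 0" using assms by simp
  have S: "(\<Sum>k<n. \<sigma> k) = real n * m + \<sigma> j"
    using n by (simp add: m_def local_field_def)
  have "(real n * m + \<sigma> j)\<^sup>2 = real n * real n * m\<^sup>2 + 2 * real n * m * \<sigma> j + 1"
    using spin_sq[OF assms] by (simp add: power2_eq_square algebra_simps)
  then show ?thesis
    unfolding exp_add[symmetric] m_def[symmetric]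
    using n cw_hamiltonian_eq[OF assms(1), of \<beta>] unfolding S
    by (simp add: field_simps)
qed

lemma flip_spin_configs: "\<sigma> \<in> spin_configs n \<Longrightarrow> j < n \<Longrightarrow> \<sigma>(j := - \<sigma> j) \<in> spin_configs n"
  unfolding spin_configs_def by (auto simp: PiE_iff extensional_def)

lemma local_field_upd: "j < n \<Longrightarrow> local_field n j (\<sigma>(j := t)) = local_field n j \<sigma>"
  unfolding local_field_def by (subst sum_upd_eq) auto

text \<open>Both sides equal \<open>1 / cosh x\<close>. This is detailed balance between the weights
  \<open>exp x\<close>, \<open>exp (- x)\<close> of the two spin values and their conditional
  probabilities.\<close>

lemma exp_tanh_balance: "exp x * (1 - tanh x) = exp (- x) * (1 + tanh (x::real))"
proof -
  have "1 - tanh x = exp (- x) / cosh x" "1 + tanh x = exp x / cosh x"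
    by (simp_all add: tanh_def field_simps cosh_minus_sinh cosh_plus_sinh)
  then show ?thesis by simp
qed

text \<open>Given the other spins, \<open>\<sigma>\<^sub>j\<close> is \<open>\<plusminus>1\<close> with probabilities \<open>(1 \<plusminus> tanh (\<beta> m\<^sub>j)) / 2\<close>.
  The identity is proved by pairing each configuration with the one in which \<open>\<sigma>\<^sub>j\<close> is flipped.\<close>

lemma cw_mean_single_spin:
  assumes "j < n"
  shows "cw_mean \<beta> n (\<lambda>\<sigma>. \<sigma> j * f \<sigma>) =
    cw_mean \<beta> n (\<lambda>\<sigma>. tanh (\<beta> * local_field n j \<sigma>) * f \<sigma>)
    + cw_mean \<beta> n (\<lambda>\<sigma>. (1 - (tanh (\<beta> * local_field n j \<sigma>))\<^sup>2)
        * ((f (\<sigma>(j := 1)) - f (\<sigma>(j := -1))) / 2))"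
proof -
  define \<tau> where "\<tau> \<sigma> = tanh (\<beta> * local_field n j \<sigma>)" for \<sigma>
  define q where "q \<sigma> = \<sigma> j * f \<sigma> - \<tau> \<sigma> * f \<sigma> - (1 - (\<tau> \<sigma>)\<^sup>2) * ((f (\<sigma>(j := 1)) - f (\<sigma>(j := -1))) / 2)" for \<sigma>
  define w where "w \<sigma> = exp (- \<beta> * cw_hamiltonian n \<sigma>)" for \<sigma>
  define p where "p \<sigma> = \<sigma>(j := - \<sigma> j)" for \<sigma> :: "nat \<Rightarrow> real"
  have pos_case: "w \<sigma> * q \<sigma> + w (p \<sigma>) * q (p \<sigma>) = 0" if \<sigma>: "\<sigma> \<in> spin_configs n" and 1: "\<sigma> j = 1" for \<sigma>
  proof -
    define x where "x = \<beta> * local_field n j \<sigma>"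
    define \<kappa> where "\<kappa> = exp (\<beta> * real n / 2 * (local_field n j \<sigma>)\<^sup>2 + \<beta> / (2 * real n) - \<beta> / 2)"
    have p: "p \<sigma> = \<sigma>(j := -1)" "p \<sigma> \<in> spin_configs n"
      using flip_spin_configs[OF \<sigma> assms] by (simp_all add: p_def 1)
    have s: "\<sigma>(j := 1) = \<sigma>" using 1 by auto
    have w: "w \<sigma> = \<kappa> * exp x" "w (p \<sigma>) = \<kappa> * exp (- x)"
      unfolding w_def cw_weight_split[OF \<sigma> assms] cw_weight_split[OF p(2) assms]
      by (simp_all add: p(1) local_field_upd assms 1 x_def \<kappa>_def)
    have t: "\<tau> \<sigma> = tanh x" "\<tau> (p \<sigma>) = tanh x"
      by (simp_all add: \<tau>_def x_def p(1) local_field_upd assms)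
    define f2 where "f2 = f (\<sigma>(j := -1))"
    define d where "d = (f \<sigma> - f2) / 2"
    have f1: "f \<sigma> = f2 + 2 * d" by (simp add: d_def field_simps)
    have q: "q \<sigma> = (1 - tanh x) * (f2 + 2 * d - (1 + tanh x) * d)"
      "q (p \<sigma>) = - (1 + tanh x) * (f2 + (1 - tanh x) * d)"
      unfolding q_def t unfolding p(1)
      by (simp_all add: 1 s f1 f2_def[symmetric] algebra_simps power2_eq_square)
    \<comment> \<open>After detailed balance both terms have the same coefficient, and the brackets
      agree: \<open>2 * d - (1 + tanh x) * d = (1 - tanh x) * d\<close>.\<close>
    have "w \<sigma> * q \<sigma> + w (p \<sigma>) * q (p \<sigma>) =
      \<kappa> * ((exp x * (1 - tanh x)) * (f2 + 2 * d - (1 + tanh x) * d)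
          - (exp (- x) * (1 + tanh x)) * (f2 + (1 - tanh x) * d))"
      unfolding w q by algebra
    also have "\<dots> = \<kappa> * ((exp x * (1 - tanh x)) * 0)"
      unfolding exp_tanh_balance[symmetric] right_diff_distrib[symmetric]
      by (simp add: algebra_simps)
    finally show ?thesis by simp
  qed
  have pair: "w \<sigma> * q \<sigma> + w (p \<sigma>) * q (p \<sigma>) = 0" if \<sigma>: "\<sigma> \<in> spin_configs n" for \<sigma>
    using spin_cases[OF \<sigma> assms]
  proof
    assume "\<sigma> j = -1"
    then have "p \<sigma> j = 1" by (simp add: p_def)
    moreover have "p \<sigma> \<in> spin_configs n" using flip_spin_configs[OF \<sigma> assms] by (simp add: p_def)
    moreover have "p (p \<sigma>) = \<sigma>" by (auto simp: p_def)
    ultimately show ?thesis using pos_case[of "p \<sigma>"] by simp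
  qed (use pos_case \<sigma> in blast)
  have "(\<Sum>\<sigma>\<in>spin_configs n. w \<sigma> * q \<sigma>) = (\<Sum>\<sigma>\<in>spin_configs n. w (p \<sigma>) * q (p \<sigma>))"
    by (rule sum.reindex_bij_witness[of _ p p])
       (auto simp: p_def flip_spin_configs assms)
  then have "2 * (\<Sum>\<sigma>\<in>spin_configs n. w \<sigma> * q \<sigma>) =
      (\<Sum>\<sigma>\<in>spin_configs n. w \<sigma> * q \<sigma> + w (p \<sigma>) * q (p \<sigma>))"
    by (simp add: sum.distrib)
  also have "\<dots> = 0" using pair by simp
  finally have "(\<Sum>\<sigma>\<in>spin_configs n. w \<sigma> * q \<sigma>) = 0" by simp
  then have "cw_mean \<beta> n q = 0"
    by (simp add: cw_mean_def w_def sum_divide_distrib[symmetric])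
  then show ?thesis
    unfolding q_def cw_mean_diff \<tau>_def by simp
qed

text \<open>The single spin identity with the total spin \<open>S\<close> as test function bounds
  \<open>E S\<^sup>2\<close> by \<open>b E S\<^sup>2 + b + 2 n\<close> with
  \<open>b = max \<beta> 0\<close>; as \<open>b < 1\<close>, this can be solved. The 3 comes from
  \<open>b + 2 n \<le> 3 n\<close>.\<close>

lemma cw_second_moment:
  assumes "\<beta> < 1" "n \<ge> 1"
  shows "cw_mean \<beta> n (\<lambda>\<sigma>. (\<Sum>k<n. \<sigma> k)\<^sup>2) \<le> 3 / (1 - max \<beta> 0) * real n"
proof -
  define b where "b = max \<beta> 0"
  define S where "S \<sigma> = (\<Sum>k<n. \<sigma> k)" for \<sigma> :: "nat \<Rightarrow> real"
  define \<tau> where "\<tau> j \<sigma> = tanh (\<beta> * local_field n j \<sigma>)" for j \<sigma>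
  have n: "real n > 0" and b: "0 \<le> b" "b < 1" using assms by (auto simp: b_def)
  have "cw_mean \<beta> n (\<lambda>\<sigma>. (S \<sigma>)\<^sup>2) = cw_mean \<beta> n (\<lambda>\<sigma>. \<Sum>j<n. \<sigma> j * S \<sigma>)"
    by (simp add: S_def power2_eq_square sum_distrib_right)
  also have "\<dots> = (\<Sum>j<n. cw_mean \<beta> n (\<lambda>\<sigma>. \<sigma> j * S \<sigma>))"
    by (rule cw_mean_sum)
  also have "\<dots> = (\<Sum>j<n. cw_mean \<beta> n (\<lambda>\<sigma>. \<tau> j \<sigma> * S \<sigma>)
      + cw_mean \<beta> n (\<lambda>\<sigma>. (1 - (\<tau> j \<sigma>)\<^sup>2) * ((S (\<sigma>(j := 1)) - S (\<sigma>(j := -1))) / 2)))"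
    unfolding \<tau>_def by (intro sum.cong cw_mean_single_spin) auto
  \<comment> \<open>Flipping spin \<open>j\<close> from -1 to 1 changes \<open>S\<close> by 2, so
    the half difference of \<open>S\<close> is exactly 1.\<close>
  also have "\<dots> = (\<Sum>j<n. cw_mean \<beta> n (\<lambda>\<sigma>. \<tau> j \<sigma> * S \<sigma> + (1 - (\<tau> j \<sigma>)\<^sup>2)))"
    unfolding cw_mean_add[symmetric] by (intro sum.cong) (auto simp: S_def sum_upd_eq simp del: fun_upd_apply)
  also have "\<dots> = cw_mean \<beta> n (\<lambda>\<sigma>. \<Sum>j<n. \<tau> j \<sigma> * S \<sigma> + (1 - (\<tau> j \<sigma>)\<^sup>2))"
    by (rule cw_mean_sum[symmetric])
  also have "\<dots> \<le> cw_mean \<beta> n (\<lambda>\<sigma>. b * (S \<sigma>)\<^sup>2 + (b + 2 * real n))"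
  proof (rule cw_mean_mono)
    fix \<sigma> assume \<sigma>: "\<sigma> \<in> spin_configs n"
    \<comment> \<open>The summand 2 collects 1 for \<open>\<sigma> j * tanh (\<beta> * m)\<close>
      and 1 for \<open>1 - (\<tau> j \<sigma>)\<^sup>2\<close>.\<close>
    have "(\<Sum>j<n. \<tau> j \<sigma> * S \<sigma> + (1 - (\<tau> j \<sigma>)\<^sup>2))
        \<le> (\<Sum>j<n. b / real n * (S \<sigma> - \<sigma> j)\<^sup>2 + 2)"
    proof (rule sum_mono)
      fix j assume "j \<in> {..<n}"
      then have j: "j < n" by simp
      define m where "m = local_field n j \<sigma>"
      have S: "S \<sigma> = real n * m + \<sigma> j" using n by (simp add: m_def local_field_def S_def)
      have "\<tau> j \<sigma> * S \<sigma> = real n * (m * tanh (\<beta> * m)) + \<sigma> j * tanh (\<beta> * m)"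
        by (simp add: S \<tau>_def m_def algebra_simps)
      also have "\<dots> \<le> real n * (b * m\<^sup>2) + 1"
      proof (rule add_mono)
        show "real n * (m * tanh (\<beta> * m)) \<le> real n * (b * m\<^sup>2)"
          unfolding b_def by (intro mult_left_mono mult_tanh_le) auto
        show "\<sigma> j * tanh (\<beta> * m) \<le> 1"
          using spin_cases[OF \<sigma> j] abs_tanh_le_1[of "\<beta> * m"] by auto
      qed
      also have "real n * (b * m\<^sup>2) = b / real n * (S \<sigma> - \<sigma> j)\<^sup>2"
        unfolding S using n by (simp add: power2_eq_square field_simps)
      finally show "\<tau> j \<sigma> * S \<sigma> + (1 - (\<tau> j \<sigma>)\<^sup>2) \<le> b / real n * (S \<sigma> - \<sigma> j)\<^sup>2 + 2"
        by (smt (verit) zero_le_power2)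
    qed
    also have "\<dots> = b / real n * (\<Sum>j<n. (S \<sigma> - \<sigma> j)\<^sup>2) + 2 * real n"
      by (simp add: sum.distrib sum_distrib_left)
    also have "(\<Sum>j<n. (S \<sigma> - \<sigma> j)\<^sup>2) = (\<Sum>j<n. (S \<sigma>)\<^sup>2 + 1 - 2 * S \<sigma> * \<sigma> j)"
      using spin_sq[OF \<sigma>] by (intro sum.cong) (auto simp: power2_eq_square algebra_simps)
    also have "\<dots> = real n * ((S \<sigma>)\<^sup>2 + 1) - 2 * S \<sigma> * S \<sigma>"
      by (simp add: sum_subtractf sum_distrib_left[symmetric] S_def)
    \<comment> \<open>The term \<open>- 2 * S \<sigma> * S \<sigma>\<close> is never positive and is
      dropped.\<close>
    also have "b / real n * (real n * ((S \<sigma>)\<^sup>2 + 1) - 2 * S \<sigma> * S \<sigma>) + 2 * real n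
        \<le> b / real n * (real n * ((S \<sigma>)\<^sup>2 + 1)) + 2 * real n"
      using b by (intro add_right_mono mult_left_mono) auto
    also have "\<dots> = b * (S \<sigma>)\<^sup>2 + (b + 2 * real n)"
      using n by (simp add: field_simps)
    finally show "(\<Sum>j<n. \<tau> j \<sigma> * S \<sigma> + (1 - (\<tau> j \<sigma>)\<^sup>2)) \<le> b * (S \<sigma>)\<^sup>2 + (b + 2 * real n)" .
  qed
  also have "\<dots> = b * cw_mean \<beta> n (\<lambda>\<sigma>. (S \<sigma>)\<^sup>2) + (b + 2 * real n)"
    by (simp only: cw_mean_add cw_mean_cmult cw_mean_const)
  finally have "(1 - b) * cw_mean \<beta> n (\<lambda>\<sigma>. (S \<sigma>)\<^sup>2) \<le> b + 2 * real n"
    by (simp add: algebra_simps)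
  also have "\<dots> \<le> 3 * real n" using b assms(2) by simp
  finally show ?thesis using b unfolding S_def b_def[symmetric] by (simp add: field_simps)
qed

text \<open>The prices of the replacements in the equation for one spin:
  \<open>\<bar>\<beta>\<bar>\<close> for the local field by the full mean, the
  \<open>\<beta>\<^sup>2\<close> term (\<open>n\<close> times a bound on the mean square of
  \<open>\<beta> m\<^sub>j\<close>) for tanh by its argument and for dropping tanh^2, and 2 for the
  half difference by a derivative.\<close>

definition cw_const :: "real \<Rightarrow> real" where
  "cw_const \<beta> = \<bar>\<beta>\<bar> + 2 * \<beta>\<^sup>2 * (3 / (1 - max \<beta> 0) + 1) + 2"

lemma cw_const_pos: "\<beta> < 1 \<Longrightarrow> cw_const \<beta> > 0"
  unfolding cw_const_def by (intro add_nonneg_pos add_nonneg_nonneg mult_nonneg_nonneg) auto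

section \<open>Linear equations for the spins against a test function\<close>

lemma local_field_sq_le:
  assumes "\<sigma> \<in> spin_configs n" "j < n"
  shows "(local_field n j \<sigma>)\<^sup>2 \<le> 2 * ((\<Sum>k<n. \<sigma> k)\<^sup>2 + 1) / (real n)\<^sup>2"
proof -
  define S where "S = (\<Sum>k<n. \<sigma> k)"
  have "0 \<le> (S + \<sigma> j)\<^sup>2" by simp
  then have "(S - \<sigma> j)\<^sup>2 \<le> 2 * (S\<^sup>2 + 1)"
    using spin_sq[OF assms] by (simp add: power2_eq_square algebra_simps)
  then show ?thesis
    unfolding local_field_def S_def[symmetric] power_divide by (intro divide_right_mono) auto
qed

lemma cw_mean_local_field_sq_le:
  assumes "\<beta> < 1" "j < n"
  shows "cw_mean \<beta> n (\<lambda>\<sigma>. (local_field n j \<sigma>)\<^sup>2) \<le> 2 * (3 / (1 - max \<beta> 0) + 1) / real n"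
proof -
  define K where "K = 3 / (1 - max \<beta> 0)"
  have n: "real n \<ge> 1" using assms by simp
  have "cw_mean \<beta> n (\<lambda>\<sigma>. (local_field n j \<sigma>)\<^sup>2)
      \<le> cw_mean \<beta> n (\<lambda>\<sigma>. 2 / (real n)\<^sup>2 * ((\<Sum>k<n. \<sigma> k)\<^sup>2 + 1))"
    using local_field_sq_le[OF _ assms(2)] by (intro cw_mean_mono) (auto simp: algebra_simps)
  also have "\<dots> = 2 / (real n)\<^sup>2 * (cw_mean \<beta> n (\<lambda>\<sigma>. (\<Sum>k<n. \<sigma> k)\<^sup>2) + 1)"
    by (simp only: cw_mean_add cw_mean_cmult cw_mean_const)
  also have "\<dots> \<le> 2 / (real n)\<^sup>2 * (K * real n + real n)"
    using cw_second_moment[of \<beta> n] assms n unfolding K_def[symmetric]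
    by (intro mult_left_mono add_mono) auto
  also have "\<dots> = 2 * (K + 1) / real n"
    using n by (simp add: power2_eq_square field_simps)
  finally show ?thesis by (simp add: K_def)
qed

text \<open>Here \<open>f \<sigma> = F (\<epsilon> \<sigma> + v)\<close> is a test function and \<open>G j\<close> its derivatives; the linearised
  equation is closed by summing over \<open>j\<close>.\<close>

context
  fixes \<beta> :: real and n :: nat and F :: "(nat \<Rightarrow> real) \<Rightarrow> real"
    and G :: "nat \<Rightarrow> (nat \<Rightarrow> real) \<Rightarrow> real" and a b c \<epsilon> :: real and v :: "nat \<Rightarrow> real"
  assumes \<beta>: "\<beta> < 1"
    and F: "\<And>x. \<bar>F x\<bar> \<le> a" "has_partials n F G"
    and G: "\<And>j x. j < n \<Longrightarrow> \<bar>G j x\<bar> \<le> b" "\<And>j. j < n \<Longrightarrow> l1_lipschitz n c (G j)"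
    and \<epsilon>: "\<bar>\<epsilon>\<bar> \<le> 1 / sqrt (real n)"
    and c: "c \<ge> 0"
begin

text \<open>A flip moves one coordinate by \<open>2 * \<bar>\<epsilon>\<bar>\<close>, so the mean
  value theorem writes the half difference as \<open>\<epsilon>\<close> times \<open>G j\<close> at
  a point within that distance; the supremum and Lipschitz bounds on \<open>G j\<close> do the
  rest.\<close>

lemma half_difference_le:
  assumes "\<sigma> \<in> spin_configs n" "j < n"
  defines "f \<equiv> \<lambda>\<sigma>. F (\<lambda>k. \<epsilon> * \<sigma> k + v k)"
  shows "\<bar>(f (\<sigma>(j := 1)) - f (\<sigma>(j := -1))) / 2\<bar> \<le> b / sqrt (real n)"
    and "\<bar>(f (\<sigma>(j := 1)) - f (\<sigma>(j := -1))) / 2 - \<epsilon> * G j (\<lambda>k. \<epsilon> * \<sigma> k + v k)\<bar> \<le> 2 * c / real n"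
proof -
  define y where "y = (\<lambda>k. \<epsilon> * \<sigma> k + v k)"
  have upd: "(\<lambda>k. \<epsilon> * (\<sigma>(j := t)) k + v k) = y(j := \<epsilon> * t + v j)" for t
    by (auto simp: y_def)
  have n: "real n > 0" using assms by simp
  obtain \<xi> where "F (y(j := \<epsilon> * 1 + v j)) - F (y(j := \<epsilon> * (-1) + v j)) = G j (y(j := \<xi>)) *
      ((\<epsilon> * 1 + v j) - (\<epsilon> * (-1) + v j))"
    and \<xi>: "\<bar>\<xi> - (\<epsilon> * (-1) + v j)\<bar> \<le> \<bar>(\<epsilon> * 1 + v j) - (\<epsilon> * (-1) + v j)\<bar>"
      "\<bar>\<xi> - (\<epsilon> * 1 + v j)\<bar> \<le> \<bar>(\<epsilon> * 1 + v j) - (\<epsilon> * (-1) + v j)\<bar>"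
    using partial_mvt[OF F(2) assms(2), of y] by blast
  then have diff: "(f (\<sigma>(j := 1)) - f (\<sigma>(j := -1))) / 2 = G j (y(j := \<xi>)) * \<epsilon>"
    unfolding f_def upd by simp
  have "\<bar>G j (y(j := \<xi>)) * \<epsilon>\<bar> \<le> b * (1 / sqrt (real n))"
    unfolding abs_mult using \<epsilon> G(1)[OF assms(2), of "y(j := \<xi>)"] by (intro mult_mono) auto
  then show "\<bar>(f (\<sigma>(j := 1)) - f (\<sigma>(j := -1))) / 2\<bar> \<le> b / sqrt (real n)"
    unfolding diff by simp
  have "l1_dist n (y(j := \<xi>)) y = l1_dist n (y(j := \<xi>)) (y(j := y j))" by simp
  also have "\<dots> = \<bar>\<xi> - y j\<bar>" by (rule l1_dist_fun_upd[OF assms(2)])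
  \<comment> \<open>As \<open>\<sigma> j\<close> is 1 or -1, \<open>y j\<close> is one of the two
    end points, and \<open>\<xi>\<close> is close to both.\<close>
  also have "\<dots> \<le> 2 * \<bar>\<epsilon>\<bar>" using spin_cases[OF assms(1,2)] \<xi> by (auto simp: y_def)
  finally have dist: "l1_dist n (y(j := \<xi>)) y \<le> 2 * \<bar>\<epsilon>\<bar>" .
  have "\<bar>G j (y(j := \<xi>)) * \<epsilon> - \<epsilon> * G j y\<bar> = \<bar>G j (y(j := \<xi>)) - G j y\<bar> * \<bar>\<epsilon>\<bar>"
    by (simp add: abs_mult[symmetric] algebra_simps)
  also have "\<dots> \<le> (c * (2 * \<bar>\<epsilon>\<bar>)) * \<bar>\<epsilon>\<bar>"
    using order_trans[OF l1_lipschitzD[OF G(2)[OF assms(2)]] mult_left_mono[OF dist c]]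
    by (intro mult_right_mono) auto
  also have "\<dots> = 2 * c * (\<bar>\<epsilon>\<bar> * \<bar>\<epsilon>\<bar>)" by simp
  also have "\<dots> \<le> 2 * c * (1 / sqrt (real n) * (1 / sqrt (real n)))"
    using \<epsilon> c n by (intro mult_left_mono mult_mono) auto
  also have "\<dots> = 2 * c / real n" using n by simp
  finally show "\<bar>(f (\<sigma>(j := 1)) - f (\<sigma>(j := -1))) / 2 - \<epsilon> * G j (\<lambda>k. \<epsilon> * \<sigma> k + v k)\<bar> \<le> 2 * c / real n"
    unfolding diff y_def .
qed

lemma bounds_nonneg: "n > 0 \<Longrightarrow> a \<ge> 0 \<and> b \<ge> 0"
  using F(1)[of "\<lambda>_. 0"] G(1)[of 0 "\<lambda>_. 0"] by auto

text \<open>With \<open>\<beta> / n\<close> times the total spin in place of the tanh term, the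
  equations for different \<open>j\<close> all contain the same unknown, the mean of the total spin
  times \<open>f\<close>; this lets them be solved together.\<close>

lemma cw_mean_spin_linearised:
  assumes j: "j < n"
  defines "f \<equiv> \<lambda>\<sigma>. F (\<lambda>k. \<epsilon> * \<sigma> k + v k)"
  shows "\<bar>cw_mean \<beta> n (\<lambda>\<sigma>. \<sigma> j * f \<sigma>) - \<beta> / real n * cw_mean \<beta> n (\<lambda>\<sigma>. (\<Sum>k<n. \<sigma> k) * f \<sigma>)
      - \<epsilon> * cw_mean \<beta> n (\<lambda>\<sigma>. G j (\<lambda>k. \<epsilon> * \<sigma> k + v k))\<bar>
    \<le> cw_const \<beta> * (a + c + b / sqrt (real n)) / real n"
proof -
  define Q where "Q = 2 * (3 / (1 - max \<beta> 0) + 1)"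
  define \<Delta> where "\<Delta> \<sigma> = (f (\<sigma>(j := 1)) - f (\<sigma>(j := -1))) / 2" for \<sigma>
  define m where "m = local_field n j"
  define S where "S \<sigma> = (\<Sum>k<n. \<sigma> k)" for \<sigma> :: "nat \<Rightarrow> real"
  define gj where "gj \<sigma> = G j (\<lambda>k. \<epsilon> * \<sigma> k + v k)" for \<sigma>
  define \<tau> where "\<tau> \<sigma> = tanh (\<beta> * m \<sigma>)" for \<sigma>
  note expand = cw_mean_add[of \<beta> n] cw_mean_diff[of \<beta> n] cw_mean_cmult[of \<beta> n] cw_mean_const[of \<beta> n]
  have n: "real n > 0" "n > 0" and Q: "Q \<ge> 0" using j \<beta> by (auto simp: Q_def)
  have "cw_const \<beta> = \<bar>\<beta>\<bar> + \<beta>\<^sup>2 * Q + 2" by (simp add: cw_const_def Q_def)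
  then have const: "\<bar>\<beta>\<bar> + \<beta>\<^sup>2 * Q \<le> cw_const \<beta>" "\<beta>\<^sup>2 * Q \<le> cw_const \<beta>" "2 \<le> cw_const \<beta>"
    using Q by auto
  note ab = bounds_nonneg[OF n(2)]
  have m2: "cw_mean \<beta> n (\<lambda>\<sigma>. (m \<sigma>)\<^sup>2) \<le> Q / real n"
    unfolding m_def Q_def by (rule cw_mean_local_field_sq_le[OF \<beta> j])
  have single: "cw_mean \<beta> n (\<lambda>\<sigma>. \<sigma> j * f \<sigma>)
      = cw_mean \<beta> n (\<lambda>\<sigma>. \<tau> \<sigma> * f \<sigma>) + cw_mean \<beta> n (\<lambda>\<sigma>. (1 - (\<tau> \<sigma>)\<^sup>2) * \<Delta> \<sigma>)"
    unfolding \<tau>_def m_def \<Delta>_def by (rule cw_mean_single_spin[OF j])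
  \<comment> \<open>Tanh against its argument costs
    \<open>\<beta>\<^sup>2 * (m \<sigma>)\<^sup>2\<close>; the field without spin \<open>j\<close>
    against the full mean costs \<open>\<bar>\<beta>\<bar> / real n\<close>.\<close>
  have 1: "\<bar>cw_mean \<beta> n (\<lambda>\<sigma>. \<tau> \<sigma> * f \<sigma> - \<beta> / real n * (S \<sigma> * f \<sigma>))\<bar>
      \<le> cw_mean \<beta> n (\<lambda>\<sigma>. a * (\<bar>\<beta>\<bar> / real n + \<beta>\<^sup>2 * (m \<sigma>)\<^sup>2))"
  proof (rule cw_mean_abs_le)
    fix \<sigma> assume \<sigma>: "\<sigma> \<in> spin_configs n"
    have "S \<sigma> = real n * m \<sigma> + \<sigma> j" using n by (simp add: m_def local_field_def S_def)
    then have "\<tau> \<sigma> * f \<sigma> - \<beta> / real n * (S \<sigma> * f \<sigma>) = f \<sigma> * ((\<tau> \<sigma> - \<beta> * m \<sigma>) - \<beta> / real n * \<sigma> j)"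
      using n by (simp add: field_simps)
    also have "\<bar>\<dots>\<bar> \<le> a * (\<bar>\<beta>\<bar> / real n + \<beta>\<^sup>2 * (m \<sigma>)\<^sup>2)"
      unfolding abs_mult
    proof (rule mult_mono)
      show "\<bar>f \<sigma>\<bar> \<le> a" unfolding f_def by (rule F(1))
      have "\<bar>\<tau> \<sigma> - \<beta> * m \<sigma>\<bar> \<le> \<beta>\<^sup>2 * (m \<sigma>)\<^sup>2"
        unfolding \<tau>_def power_mult_distrib[symmetric] by (rule abs_tanh_diff_le)
      moreover have "\<bar>\<beta> / real n * \<sigma> j\<bar> = \<bar>\<beta>\<bar> / real n"
        using spin_cases[OF \<sigma> j] by auto
      ultimately show "\<bar>(\<tau> \<sigma> - \<beta> * m \<sigma>) - \<beta> / real n * \<sigma> j\<bar> \<le> \<bar>\<beta>\<bar> / real n + \<beta>\<^sup>2 * (m \<sigma>)\<^sup>2"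
        by linarith
    qed (use ab in auto)
    finally show "\<bar>\<tau> \<sigma> * f \<sigma> - \<beta> / real n * (S \<sigma> * f \<sigma>)\<bar> \<le> a * (\<bar>\<beta>\<bar> / real n + \<beta>\<^sup>2 * (m \<sigma>)\<^sup>2)" .
  qed
  \<comment> \<open>Both factors are small: the half difference is of order
    \<open>b / sqrt (real n)\<close> and the mean of tanh^2 of order \<open>1 / real n\<close>;
    hence the better power of \<open>n\<close> next to \<open>b\<close>.\<close>
  have 2: "\<bar>cw_mean \<beta> n (\<lambda>\<sigma>. (\<tau> \<sigma>)\<^sup>2 * \<Delta> \<sigma>)\<bar>
      \<le> cw_mean \<beta> n (\<lambda>\<sigma>. b / sqrt (real n) * (\<beta>\<^sup>2 * (m \<sigma>)\<^sup>2))"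
  proof (rule cw_mean_abs_le)
    fix \<sigma> assume \<sigma>: "\<sigma> \<in> spin_configs n"
    have "\<bar>(\<tau> \<sigma>)\<^sup>2\<bar> * \<bar>\<Delta> \<sigma>\<bar> \<le> (\<beta>\<^sup>2 * (m \<sigma>)\<^sup>2) * (b / sqrt (real n))"
      using half_difference_le(1)[OF \<sigma> j] tanh_sq_le[of "\<beta> * m \<sigma>"]
      unfolding \<Delta>_def f_def \<tau>_def by (intro mult_mono) (auto simp: power_mult_distrib)
    then show "\<bar>(\<tau> \<sigma>)\<^sup>2 * \<Delta> \<sigma>\<bar> \<le> b / sqrt (real n) * (\<beta>\<^sup>2 * (m \<sigma>)\<^sup>2)"
      by (simp add: abs_mult mult_ac)
  qed
  have 3: "\<bar>cw_mean \<beta> n (\<lambda>\<sigma>. \<Delta> \<sigma> - \<epsilon> * gj \<sigma>)\<bar> \<le> cw_mean \<beta> n (\<lambda>_. 2 * c / real n)"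
    using half_difference_le(2)[OF _ j] unfolding \<Delta>_def f_def gj_def by (rule cw_mean_abs_le)
  have "(1 - (\<tau> \<sigma>)\<^sup>2) * \<Delta> \<sigma> = \<Delta> \<sigma> - (\<tau> \<sigma>)\<^sup>2 * \<Delta> \<sigma>" for \<sigma> by (simp add: algebra_simps)
  then have split: "cw_mean \<beta> n (\<lambda>\<sigma>. \<sigma> j * f \<sigma>) - \<beta> / real n * cw_mean \<beta> n (\<lambda>\<sigma>. S \<sigma> * f \<sigma>) - \<epsilon> * cw_mean \<beta> n gj
      = cw_mean \<beta> n (\<lambda>\<sigma>. \<tau> \<sigma> * f \<sigma> - \<beta> / real n * (S \<sigma> * f \<sigma>))
        - cw_mean \<beta> n (\<lambda>\<sigma>. (\<tau> \<sigma>)\<^sup>2 * \<Delta> \<sigma>) + cw_mean \<beta> n (\<lambda>\<sigma>. \<Delta> \<sigma> - \<epsilon> * gj \<sigma>)"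
    unfolding single by (simp only: expand)
  have "\<bar>cw_mean \<beta> n (\<lambda>\<sigma>. \<sigma> j * f \<sigma>) - \<beta> / real n * cw_mean \<beta> n (\<lambda>\<sigma>. S \<sigma> * f \<sigma>) - \<epsilon> * cw_mean \<beta> n gj\<bar>
      \<le> cw_mean \<beta> n (\<lambda>\<sigma>. a * (\<bar>\<beta>\<bar> / real n + \<beta>\<^sup>2 * (m \<sigma>)\<^sup>2))
        + cw_mean \<beta> n (\<lambda>\<sigma>. b / sqrt (real n) * (\<beta>\<^sup>2 * (m \<sigma>)\<^sup>2)) + cw_mean \<beta> n (\<lambda>_. 2 * c / real n)"
    unfolding split using 1 2 3 by linarith
  also have "\<dots> = a * (\<bar>\<beta>\<bar> / real n + \<beta>\<^sup>2 * cw_mean \<beta> n (\<lambda>\<sigma>. (m \<sigma>)\<^sup>2))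
        + b / sqrt (real n) * (\<beta>\<^sup>2 * cw_mean \<beta> n (\<lambda>\<sigma>. (m \<sigma>)\<^sup>2)) + 2 * c / real n"
    by (simp only: expand)
  also have "\<dots> \<le> a * (\<bar>\<beta>\<bar> / real n + \<beta>\<^sup>2 * (Q / real n))
        + b / sqrt (real n) * (\<beta>\<^sup>2 * (Q / real n)) + 2 * c / real n"
    using ab m2 by (intro add_mono mult_left_mono) auto
  also have "\<dots> = (a * (\<bar>\<beta>\<bar> + \<beta>\<^sup>2 * Q) + b / sqrt (real n) * (\<beta>\<^sup>2 * Q) + c * 2) / real n"
    using n by (simp add: field_simps)
  also have "\<dots> \<le> (a * cw_const \<beta> + b / sqrt (real n) * cw_const \<beta> + c * cw_const \<beta>) / real n"
    using mult_left_mono[OF const(1), of a] mult_left_mono[OF const(2), of "b / sqrt (real n)"]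
      mult_left_mono[OF const(3) c] ab
    by (intro divide_right_mono add_mono) auto
  also have "\<dots> = cw_const \<beta> * (a + c + b / sqrt (real n)) / real n"
    by (simp add: algebra_simps)
  finally show ?thesis unfolding S_def gj_def .
qed

text \<open>Summing the site equations turns the shared unknown \<open>T\<close> into a scalar
  equation \<open>(1 - \<beta>) * T \<approx> \<epsilon> * (\<Sum>j<n. g' j)\<close>. Putting its
  solution back adds \<open>\<beta> / (n\<^sup>2 (1 - \<beta>))\<close> to every matrix entry, on
  top of the diagonal \<open>1 / n\<close>. This is the origin of the covariance and, for the
  errors, of the factor \<open>1 + \<bar>\<beta>\<bar> / (1 - \<beta>)\<close>.\<close>

lemma cw_mean_spin_stein:
  assumes i: "i < n"
  defines "f \<equiv> \<lambda>\<sigma>. F (\<lambda>k. \<epsilon> * \<sigma> k + v k)"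
    and "g \<equiv> \<lambda>j \<sigma>. G j (\<lambda>k. \<epsilon> * \<sigma> k + v k)"
  shows "\<bar>cw_mean \<beta> n (\<lambda>\<sigma>. \<sigma> i * f \<sigma>)
      - \<epsilon> * real n * (\<Sum>j<n. cw_covariance \<beta> n i j * cw_mean \<beta> n (g j))\<bar>
    \<le> (1 + \<bar>\<beta>\<bar> / (1 - \<beta>)) * (cw_const \<beta> * (a + c + b / sqrt (real n)) / real n)"
proof -
  define \<eta> where "\<eta> = cw_const \<beta> * (a + c + b / sqrt (real n)) / real n"
  define T where "T = cw_mean \<beta> n (\<lambda>\<sigma>. (\<Sum>k<n. \<sigma> k) * f \<sigma>)"
  define A where "A j = cw_mean \<beta> n (\<lambda>\<sigma>. \<sigma> j * f \<sigma>)" for j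
  define g' where "g' j = cw_mean \<beta> n (g j)" for j
  have n: "real n > 0" using i by simp
  have site: "\<bar>A j - \<beta> / real n * T - \<epsilon> * g' j\<bar> \<le> \<eta>" if "j < n" for j
    using cw_mean_spin_linearised[OF that]
    unfolding A_def T_def g'_def \<eta>_def f_def g_def .
  have T: "T = (\<Sum>j<n. A j)"
    unfolding T_def A_def sum_distrib_right by (rule cw_mean_sum)
  have "(1 - \<beta>) * T - \<epsilon> * (\<Sum>j<n. g' j) = (\<Sum>j<n. A j - \<beta> / real n * T - \<epsilon> * g' j)"
    using n by (simp add: sum_subtractf sum_distrib_left[symmetric] T[symmetric] left_diff_distrib)
  also have "\<bar>\<dots>\<bar> \<le> (\<Sum>j<n. \<bar>A j - \<beta> / real n * T - \<epsilon> * g' j\<bar>)" by (rule sum_abs)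
  also have "\<dots> \<le> (\<Sum>j<n. \<eta>)" by (intro sum_mono site) auto
  finally have total: "\<bar>(1 - \<beta>) * T - \<epsilon> * (\<Sum>j<n. g' j)\<bar> \<le> real n * \<eta>" by simp
  \<comment> \<open>\<open>s\<close> has two roles: \<open>s / real n\<close> is the constant part
    of the covariance, and \<open>s\<close> converts \<open>(1 - \<beta>) * T\<close> into
    \<open>\<beta> / real n * T\<close>. Their agreement makes the matrix come out exactly.\<close>
  define s where "s = \<beta> / (real n * (1 - \<beta>))"
  have "(\<Sum>j<n. cw_covariance \<beta> n i j * g' j)
      = (\<Sum>j<n. (if j = i then 1 / real n * g' i else 0) + s / real n * g' j)"
    by (intro sum.cong) (auto simp: cw_covariance_def s_def power2_eq_square distrib_right)
  also have "\<dots> = 1 / real n * g' i + s / real n * (\<Sum>j<n. g' j)"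
    using i by (simp add: sum.distrib sum_distrib_left)
  finally have cov: "\<epsilon> * real n * (\<Sum>j<n. cw_covariance \<beta> n i j * g' j)
      = \<epsilon> * g' i + s * (\<epsilon> * (\<Sum>j<n. g' j))"
    using n by (simp add: field_simps)
  have "\<beta> / real n * T = s * ((1 - \<beta>) * T)" using \<beta> n by (simp add: s_def)
  then have "A i - \<epsilon> * real n * (\<Sum>j<n. cw_covariance \<beta> n i j * g' j)
      = (A i - \<beta> / real n * T - \<epsilon> * g' i) + s * ((1 - \<beta>) * T - \<epsilon> * (\<Sum>j<n. g' j))"
    unfolding cov by (simp add: algebra_simps)
  also have "\<bar>\<dots>\<bar> \<le> \<eta> + \<bar>s\<bar> * (real n * \<eta>)"
    using site[OF i] mult_left_mono[OF total, of "\<bar>s\<bar>"] by (simp add: abs_mult[symmetric])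
  also have "\<dots> = (1 + \<bar>\<beta>\<bar> / (1 - \<beta>)) * \<eta>"
    using \<beta> n by (simp add: s_def abs_mult field_simps)
  finally show ?thesis unfolding A_def g'_def \<eta>_def .
qed

end

section \<open>Gaussian integration by parts\<close>

abbreviation std_normal :: "real measure" where
  "std_normal \<equiv> density lborel (\<lambda>x. ennreal (std_normal_density x))"

section \<open>The one-dimensional standard normal law\<close>

lemma prob_space_std_normal: "prob_space std_normal"
  using prob_space_normal_density[of 1 0] by simp

lemma integral_std_normal:
  assumes "f \<in> borel_measurable borel"
  shows "(\<integral>x. f x \<partial>std_normal) = (\<integral>x. std_normal_density x * f x \<partial>lborel)"
  using assms by (subst integral_density) auto

lemma integrable_std_normal_iff:
  fixes f :: "real \<Rightarrow> real"
  assumes "f \<in> borel_measurable borel"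
  shows "integrable std_normal f \<longleftrightarrow> integrable lborel (\<lambda>x. std_normal_density x * f x)"
  using assms by (subst integrable_density) auto

lemma has_real_derivative_std_normal_density:
  "(std_normal_density has_real_derivative - x * std_normal_density x) (at x)"
proof -
  define c where "c = 1 / sqrt (2 * pi)"
  have "((\<lambda>x. c * exp (- x\<^sup>2 / 2)) has_real_derivative - x * (c * exp (- x\<^sup>2 / 2))) (at x)"
    by (auto intro!: derivative_eq_intros)
  then show ?thesis by (simp add: std_normal_density_def[abs_def] c_def)
qed

text \<open>The hypothesis on the squares covers the limits at both ends of the line at
  once.\<close>

lemma tendsto_std_normal_density:
  assumes "filterlim (\<lambda>x::real. x\<^sup>2) at_top net"
  shows "(std_normal_density \<longlongrightarrow> 0) net"
proof -
  have "filterlim (\<lambda>x::real. x\<^sup>2 * (1/2)) at_top net"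
    by (rule filterlim_at_top_mult_tendsto_pos[OF tendsto_const _ assms]) auto
  then have "filterlim (\<lambda>x::real. - (x\<^sup>2 * (1/2))) at_bot net"
    by (simp add: filterlim_uminus_at_bot)
  then have "((\<lambda>x::real. exp (- (x\<^sup>2 * (1/2)))) \<longlongrightarrow> 0) net"
    by (rule filterlim_compose[OF exp_at_bot])
  then have "((\<lambda>x::real. 1 / sqrt (2 * pi) * exp (- (x\<^sup>2 * (1/2)))) \<longlongrightarrow> 1 / sqrt (2 * pi) * 0) net"
    by (intro tendsto_intros)
  then show ?thesis by (simp add: std_normal_density_def[abs_def])
qed

text \<open>Since the density satisfies \<open>\<phi>' = - t \<phi>\<close>, the function
  \<open>\<phi> f' - \<phi> t f\<close> is the derivative of \<open>f \<phi>\<close>, which vanishes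
  at both infinities because \<open>f\<close> is bounded. Continuity of \<open>f'\<close> gives
  access to the fundamental theorem on the whole line.\<close>

lemma std_normal_integration_by_parts:
  fixes f :: "real \<Rightarrow> real"
  assumes deriv: "\<And>t. (f has_real_derivative f' t) (at t)" and cont: "continuous_on UNIV f'"
    and bound: "\<And>t. \<bar>f t\<bar> \<le> a" "\<And>t. \<bar>f' t\<bar> \<le> b"
  shows "(\<integral>t. t * f t \<partial>std_normal) = (\<integral>t. f' t \<partial>std_normal)"
proof -
  let ?\<phi> = std_normal_density
  have contf: "continuous_on UNIV f"
    using deriv DERIV_isCont by (blast intro: continuous_at_imp_continuous_on)
  have [measurable]: "f \<in> borel_measurable borel" "f' \<in> borel_measurable borel"
    by (rule borel_measurable_continuous_onI, fact)+
  have int: "integrable lborel (\<lambda>t. ?\<phi> t * f' t)" "integrable lborel (\<lambda>t. ?\<phi> t * (t * f t))"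
  proof -
    \<comment> \<open>The power 0 presents the majorant as an absolute moment, the zeroth.\<close>
    have "integrable lborel (\<lambda>t. b * (?\<phi> t * \<bar>t\<bar>^0))"
      by (intro integrable_mult_right integrable_std_normal_moment_abs)
    then show "integrable lborel (\<lambda>t. ?\<phi> t * f' t)"
      by (rule Bochner_Integration.integrable_bound)
        (use bound(2) in \<open>auto simp: abs_mult mult.commute[of b] intro!: mult_left_mono order_trans[OF _ abs_ge_self]\<close>)
    have "integrable lborel (\<lambda>t. a * (?\<phi> t * \<bar>t\<bar>^1))"
      by (intro integrable_mult_right integrable_std_normal_moment_abs)
    then show "integrable lborel (\<lambda>t. ?\<phi> t * (t * f t))"
    proof (rule Bochner_Integration.integrable_bound)
      show "AE t in lborel. norm (?\<phi> t * (t * f t)) \<le> norm (a * (?\<phi> t * \<bar>t\<bar>^1))"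
      proof (rule AE_I2)
        fix t
        have "(?\<phi> t * \<bar>t\<bar>) * \<bar>f t\<bar> \<le> (?\<phi> t * \<bar>t\<bar>) * \<bar>a\<bar>"
          using bound(1)[of t] by (intro mult_left_mono) auto
        then show "norm (?\<phi> t * (t * f t)) \<le> norm (a * (?\<phi> t * \<bar>t\<bar>^1))"
          by (simp add: abs_mult mult_ac)
      qed
    qed auto
  qed
  have contphi: "continuous_on UNIV ?\<phi>"
    using has_real_derivative_std_normal_density DERIV_isCont
    by (blast intro: continuous_at_imp_continuous_on)
  have lim: "((\<lambda>t. f t * ?\<phi> t) \<longlongrightarrow> 0) net" if "filterlim (\<lambda>x::real. x\<^sup>2) at_top net" for net
  proof (rule Lim_null_comparison)
    show "\<forall>\<^sub>F t in net. norm (f t * ?\<phi> t) \<le> a * ?\<phi> t"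
      using bound(1) by (intro always_eventually allI) (auto simp: abs_mult intro: mult_right_mono)
    show "((\<lambda>t. a * ?\<phi> t) \<longlongrightarrow> 0) net"
      using tendsto_mult_left[OF tendsto_std_normal_density[OF that], of a] by simp
  qed
  have "(LBINT t=-\<infinity>..\<infinity>. ?\<phi> t * f' t - ?\<phi> t * (t * f t)) = 0 - 0"
  proof (rule interval_integral_FTC_integrable[where F = "\<lambda>t. f t * ?\<phi> t"])
    fix t :: real
    have "((\<lambda>t. f t * ?\<phi> t) has_real_derivative ?\<phi> t * f' t - ?\<phi> t * (t * f t)) (at t)"
      by (rule derivative_eq_intros deriv has_real_derivative_std_normal_density refl)+
        (simp add: algebra_simps)
    then show "((\<lambda>t. f t * ?\<phi> t) has_vector_derivative ?\<phi> t * f' t - ?\<phi> t * (t * f t)) (at t)"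
      by (simp add: has_real_derivative_iff_has_vector_derivative)
    have "continuous_on UNIV (\<lambda>t. ?\<phi> t * f' t - ?\<phi> t * (t * f t))"
      by (intro continuous_intros contf cont contphi)
    then show "isCont (\<lambda>t. ?\<phi> t * f' t - ?\<phi> t * (t * f t)) t"
      by (simp add: continuous_on_eq_continuous_at)
  next
    show "set_integrable lborel (einterval (- \<infinity>) \<infinity>) (\<lambda>t. ?\<phi> t * f' t - ?\<phi> t * (t * f t))"
      using int by (simp add: set_integrable_def)
    have "filterlim (\<lambda>x::real. x\<^sup>2) at_top at_bot"
      by (rule filterlim_pow_at_bot_even) (auto intro: filterlim_ident)
    moreover have "filterlim (\<lambda>x::real. x\<^sup>2) at_top at_top"
      by (rule filterlim_pow_at_top) (auto intro: filterlim_ident)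
    ultimately show "(((\<lambda>t. f t * ?\<phi> t) \<circ> real_of_ereal) \<longlongrightarrow> 0) (at_right (- \<infinity>))"
      "(((\<lambda>t. f t * ?\<phi> t) \<circ> real_of_ereal) \<longlongrightarrow> 0) (at_left \<infinity>)"
      unfolding ereal_tendsto_simps by (auto intro: lim)
  qed simp
  then have "(\<integral>t. ?\<phi> t * f' t - ?\<phi> t * (t * f t) \<partial>lborel) = 0"
    by (simp add: interval_lebesgue_integral_def set_lebesgue_integral_def)
  then have "(\<integral>t. ?\<phi> t * f' t \<partial>lborel) = (\<integral>t. ?\<phi> t * (t * f t) \<partial>lborel)"
    using int by simp
  then show ?thesis by (simp add: integral_std_normal)
qed

section \<open>Vectors of independent standard normal variables\<close>

lemma std_normal_vector_prob: "prob_space (std_normal_vector m)"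
  unfolding std_normal_vector_def by (intro prob_space_PiM prob_space_std_normal)

lemma sets_std_normal_vector [measurable_cong]: "sets (std_normal_vector m) = sets (borel_Rn m)"
  unfolding std_normal_vector_def by (intro sets_PiM_cong) auto

lemma integrable_std_normal_vector_component:
  assumes "k < m"
  shows "integrable (std_normal_vector m) (\<lambda>x. x k)"
proof -
  have "distr (std_normal_vector m) std_normal (\<lambda>x. x k) = std_normal"
    unfolding std_normal_vector_def
    using assms prob_space_std_normal by (intro distr_PiM_component) auto
  moreover have "integrable std_normal (\<lambda>t. t)"
    using integrable_std_normal_moment[of 1] by (subst integrable_std_normal_iff) auto
  ultimately have "integrable (distr (std_normal_vector m) std_normal (\<lambda>x. x k)) (\<lambda>t. t)" by simp
  then show ?thesis
    by (subst (asm) integrable_distr_eq)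
      (use assms in \<open>auto simp: std_normal_vector_def\<close>)
qed

lemma integrable_bounded_lipschitz:
  assumes "l1_lipschitz m L F" "\<And>x. \<bar>F x\<bar> \<le> a"
  shows "integrable (std_normal_vector m) F"
proof -
  interpret prob_space "std_normal_vector m" by (rule std_normal_vector_prob)
  have "F \<in> borel_measurable (std_normal_vector m)"
    using l1_lipschitz_measurable[OF assms(1)] by (simp add: measurable_cong_sets[OF sets_std_normal_vector])
  then show ?thesis using assms(2) by (intro integrable_const_bound[of _ a]) auto
qed

lemma integrable_component_mult:
  assumes "l1_lipschitz m L F" "\<And>x. \<bar>F x\<bar> \<le> a" "k < m"
  shows "integrable (std_normal_vector m) (\<lambda>x. x k * F x)"
proof (rule Bochner_Integration.integrable_bound)
  show "integrable (std_normal_vector m) (\<lambda>x. a * x k)"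
    by (intro integrable_mult_right integrable_std_normal_vector_component assms(3))
  have "F \<in> borel_measurable (std_normal_vector m)"
    using l1_lipschitz_measurable[OF assms(1)] by (simp add: measurable_cong_sets[OF sets_std_normal_vector])
  then show "(\<lambda>x. x k * F x) \<in> borel_measurable (std_normal_vector m)"
    using integrable_std_normal_vector_component[OF assms(3)] by auto
  show "AE x in std_normal_vector m. norm (x k * F x) \<le> norm (a * x k)"
  proof (rule AE_I2)
    fix x :: "nat \<Rightarrow> real"
    have "\<bar>x k\<bar> * \<bar>F x\<bar> \<le> \<bar>x k\<bar> * \<bar>a\<bar>"
      using assms(2)[of x] by (intro mult_left_mono) auto
    then show "norm (x k * F x) \<le> norm (a * x k)" by (simp add: abs_mult mult_ac)
  qed
qed

text \<open>By Fubini, coordinate \<open>k\<close> is integrated first with the others frozen, which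
  reduces the claim to one variable; the Lipschitz bound on \<open>G k\<close> supplies the
  continuity of the derivative there.\<close>

lemma std_normal_vector_integration_by_parts:
  assumes F: "l1_lipschitz m L F" "\<And>x. \<bar>F x\<bar> \<le> a" "has_partials m F G"
    and G: "l1_lipschitz m L' (G k)" "\<And>x. \<bar>G k x\<bar> \<le> b" and k: "k < m"
  shows "(\<integral>x. x k * F x \<partial>std_normal_vector m) = (\<integral>x. G k x \<partial>std_normal_vector m)"
proof -
  interpret product_prob_space "\<lambda>_::nat. std_normal" UNIV
    by (intro product_prob_spaceI prob_space_std_normal)
  define I where "I = {..<m} - {k}"
  have I: "finite I" "k \<notin> I" "insert k I = {..<m}" using k by (auto simp: I_def)
  have split: "integral\<^sup>L (std_normal_vector m) f = (\<integral>x. (\<integral>t. f (x(k := t)) \<partial>std_normal) \<partial>Pi\<^sub>M I (\<lambda>_. std_normal))"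
    if "integrable (std_normal_vector m) f" for f :: "(nat \<Rightarrow> real) \<Rightarrow> real"
    using product_integral_insert[OF I(1,2), of f] that
    unfolding I(3) std_normal_vector_def by simp
  have "(\<integral>t. t * F (x(k := t)) \<partial>std_normal) = (\<integral>t. G k (x(k := t)) \<partial>std_normal)" for x
  proof (rule std_normal_integration_by_parts)
    show "((\<lambda>s. F (x(k := s))) has_real_derivative G k (x(k := t))) (at t)" for t
      by (rule has_partialsD[OF F(3) k])
    show "continuous_on UNIV (\<lambda>t. G k (x(k := t)))"
    proof (rule continuous_at_imp_continuous_on, rule ballI)
      fix t
      have "((\<lambda>s. L' * \<bar>s - t\<bar>) \<longlongrightarrow> L' * \<bar>t - t\<bar>) (at t)" by (intro tendsto_intros)
      then have lim: "((\<lambda>s. L' * \<bar>s - t\<bar>) \<longlongrightarrow> 0) (at t)" by simp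
      have "norm (G k (x(k := s)) - G k (x(k := t))) \<le> L' * \<bar>s - t\<bar>" for s
        using l1_lipschitzD[OF G(1), of "x(k := s)" "x(k := t)"] by (simp add: l1_dist_fun_upd[OF k])
      then have "((\<lambda>s. G k (x(k := s)) - G k (x(k := t))) \<longlongrightarrow> 0) (at t)"
        by (intro Lim_null_comparison[OF always_eventually lim]) blast
      then show "isCont (\<lambda>t. G k (x(k := t))) t" by (simp add: isCont_def LIM_zero_iff)
    qed
  qed (use F(2) G(2) in auto)
  then show ?thesis
    using split[OF integrable_component_mult[OF F(1,2) k]] split[OF integrable_bounded_lipschitz[OF G]]
    by simp
qed

section \<open>Rotating the spins into the Gaussian vector\<close>

lemma l1_lipschitz_cmult: "l1_lipschitz n L F \<Longrightarrow> l1_lipschitz n (\<bar>c\<bar> * L) (\<lambda>x. c * F x)"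
  unfolding l1_lipschitz_def
  by (simp add: right_diff_distrib[symmetric] abs_mult mult.assoc mult_left_mono)

lemma l1_lipschitz_sum:
  assumes "\<And>j. j \<in> J \<Longrightarrow> l1_lipschitz n (L j) (F j)"
  shows "l1_lipschitz n (\<Sum>j\<in>J. L j) (\<lambda>x. \<Sum>j\<in>J. F j x)"
  unfolding l1_lipschitz_def
proof (intro allI)
  fix x y
  have "\<bar>(\<Sum>j\<in>J. F j x) - (\<Sum>j\<in>J. F j y)\<bar> \<le> (\<Sum>j\<in>J. \<bar>F j x - F j y\<bar>)"
    unfolding sum_subtractf[symmetric] by (rule sum_abs)
  also have "\<dots> \<le> (\<Sum>j\<in>J. L j * l1_dist n x y)"
    by (intro sum_mono l1_lipschitzD assms)
  finally show "\<bar>(\<Sum>j\<in>J. F j x) - (\<Sum>j\<in>J. F j y)\<bar> \<le> (\<Sum>j\<in>J. L j) * l1_dist n x y"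
    by (simp add: sum_distrib_right)
qed

text \<open>The crude constant serves measurability, integrability and continuity; its size does not
  reach the final estimate.\<close>

lemma l1_lipschitz_affine:
  assumes "l1_lipschitz n L F" "L \<ge> 0"
  shows "l1_lipschitz m (L * (\<Sum>i<n. \<Sum>k<m. \<bar>s * A i k\<bar>))
    (\<lambda>x. F (\<lambda>i. u i + s * (\<Sum>k<m. A i k * x k)))"
  unfolding l1_lipschitz_def
proof (intro allI)
  fix x y :: "nat \<Rightarrow> real"
  define Y where "Y x = (\<lambda>i. u i + s * (\<Sum>k<m. A i k * x k))" for x :: "nat \<Rightarrow> real"
  have "\<bar>Y x i - Y y i\<bar> \<le> (\<Sum>k<m. \<bar>s * A i k\<bar>) * l1_dist m x y" for i
  proof -
    have "Y x i - Y y i = (\<Sum>k<m. s * A i k * (x k - y k))"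
      by (simp add: Y_def right_diff_distrib sum_subtractf sum_distrib_left mult.assoc)
    also have "\<bar>\<dots>\<bar> \<le> (\<Sum>k<m. \<bar>s * A i k * (x k - y k)\<bar>)" by (rule sum_abs)
    also have "\<dots> \<le> (\<Sum>k<m. \<bar>s * A i k\<bar> * l1_dist m x y)"
      unfolding abs_mult[of "s * A i _"]
      by (intro sum_mono mult_left_mono) (auto simp: l1_dist_def intro: member_le_sum)
    finally show ?thesis by (simp add: sum_distrib_right)
  qed
  then have "l1_dist n (Y x) (Y y) \<le> (\<Sum>i<n. (\<Sum>k<m. \<bar>s * A i k\<bar>) * l1_dist m x y)"
    unfolding l1_dist_def[of n] by (intro sum_mono)
  then have "L * l1_dist n (Y x) (Y y) \<le> L * ((\<Sum>i<n. \<Sum>k<m. \<bar>s * A i k\<bar>) * l1_dist m x y)"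
    unfolding sum_distrib_right[symmetric] using assms(2) by (rule mult_left_mono)
  with l1_lipschitzD[OF assms(1), of "Y x" "Y y"]
  have "\<bar>F (Y x) - F (Y y)\<bar> \<le> L * ((\<Sum>i<n. \<Sum>k<m. \<bar>s * A i k\<bar>) * l1_dist m x y)" by linarith
  then show "\<bar>F (\<lambda>i. u i + s * (\<Sum>k<m. A i k * x k)) - F (\<lambda>i. u i + s * (\<Sum>k<m. A i k * y k))\<bar>
      \<le> L * (\<Sum>i<n. \<Sum>k<m. \<bar>s * A i k\<bar>) * l1_dist m x y"
    by (simp add: Y_def mult.assoc)
qed

text \<open>The \<open>k\<close>-th derivative of \<open>F (Y x)\<close> combines the
  \<open>G j\<close> with weights \<open>s * A j k\<close>; weighting again with
  \<open>A i k\<close> and summing over \<open>k\<close> produces the entries of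
  \<open>A A\<^sup>T\<close>. The shift \<open>u\<close> will hold the spins, the factor
  \<open>s\<close> the sine of the angle.\<close>

lemma MVN_integration_by_parts:
  fixes F :: "(nat \<Rightarrow> real) \<Rightarrow> real" and A :: "nat \<Rightarrow> nat \<Rightarrow> real" and u :: "nat \<Rightarrow> real" and s :: real and m :: nat
  assumes F: "l1_lipschitz n b F" "\<And>x. \<bar>F x\<bar> \<le> a" "has_partials n F G"
    and G: "\<And>j. j < n \<Longrightarrow> l1_lipschitz n c (G j)" "\<And>j x. j < n \<Longrightarrow> \<bar>G j x\<bar> \<le> b" "b \<ge> 0" "c \<ge> 0"
  defines "Y \<equiv> \<lambda>x i. u i + s * (\<Sum>k<m. A i k * x k)"
  shows "integrable (std_normal_vector m) (\<lambda>x. F (Y x))"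
    and "\<And>j. j < n \<Longrightarrow> integrable (std_normal_vector m) (\<lambda>x. G j (Y x))"
    and "integrable (std_normal_vector m) (\<lambda>x. (\<Sum>k<m. A i k * x k) * F (Y x))"
    and "(\<integral>x. (\<Sum>k<m. A i k * x k) * F (Y x) \<partial>std_normal_vector m)
      = s * (\<Sum>j<n. (\<Sum>k<m. A i k * A j k) * (\<integral>x. G j (Y x) \<partial>std_normal_vector m))"
proof -
  let ?M = "std_normal_vector m"
  have FY: "l1_lipschitz m (b * (\<Sum>i<n. \<Sum>k<m. \<bar>s * A i k\<bar>)) (\<lambda>x. F (Y x))"
    unfolding Y_def by (rule l1_lipschitz_affine[OF F(1) G(3)])
  have GY: "l1_lipschitz m (c * (\<Sum>i<n. \<Sum>k<m. \<bar>s * A i k\<bar>)) (\<lambda>x. G j (Y x))" if "j < n" for j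
    unfolding Y_def by (rule l1_lipschitz_affine[OF G(1)[OF that] G(4)])
  show intF: "integrable ?M (\<lambda>x. F (Y x))"
    by (rule integrable_bounded_lipschitz[OF FY F(2)])
  show intG: "integrable ?M (\<lambda>x. G j (Y x))" if "j < n" for j
    by (rule integrable_bounded_lipschitz[OF GY[OF that] G(2)[OF that]])
  have int: "integrable ?M (\<lambda>x. x k * F (Y x))" if "k < m" for k
    by (rule integrable_component_mult[OF FY F(2) that])
  have expand: "(\<Sum>k<m. A i k * x k) * F (Y x) = (\<Sum>k<m. A i k * (x k * F (Y x)))" for x
    by (simp add: sum_distrib_right mult.assoc)
  show "integrable ?M (\<lambda>x. (\<Sum>k<m. A i k * x k) * F (Y x))"
    unfolding expand using int by (intro Bochner_Integration.integrable_sum integrable_mult_right) auto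
  define D where "D k x = (\<Sum>j<n. (s * A j k) * G j (Y x))" for k x
  have partials: "has_partials m (\<lambda>x. F (Y x)) D"
    unfolding has_partials_def
  proof (intro allI impI)
    fix x k assume k: "k < m"
    have "((\<lambda>t. F (Y (x(k := t)))) has_real_derivative (\<Sum>j<n. G j (Y (x(k := x k))) * (s * A j k))) (at (x k))"
    proof (rule has_real_derivative_along_curve[OF l1_lipschitz_depends[OF F(1)] F(3) G(1) G(4)])
      fix j
      have "(\<Sum>l<m. A j l * (x(k := t)) l) = (\<Sum>l<m. A j l * x l) + A j k * (t - x k)" for t
      proof -
        have "(\<Sum>l<m. A j l * (x(k := t)) l - A j l * x l) = (\<Sum>l<m. if l = k then A j k * (t - x k) else 0)"
          by (intro sum.cong) (auto simp: algebra_simps)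
        then show ?thesis using k by (simp add: sum_subtractf algebra_simps del: fun_upd_apply)
      qed
      then show "((\<lambda>t. Y (x(k := t)) j) has_real_derivative s * A j k) (at (x k))"
        unfolding Y_def by (auto intro!: derivative_eq_intros)
    qed
    then show "((\<lambda>t. F (Y (x(k := t)))) has_real_derivative D k x) (at (x k))"
      by (simp add: D_def mult.commute)
  qed
  have D_lip: "l1_lipschitz m (\<Sum>j<n. \<bar>s * A j k\<bar> * (c * (\<Sum>i<n. \<Sum>k<m. \<bar>s * A i k\<bar>))) (D k)" for k
    unfolding D_def by (intro l1_lipschitz_sum l1_lipschitz_cmult GY) auto
  have D_bound: "\<bar>D k x\<bar> \<le> (\<Sum>j<n. \<bar>s * A j k\<bar> * b)" for k x
    unfolding D_def
    by (rule order_trans[OF sum_abs]) (auto simp: abs_mult intro!: sum_mono mult_left_mono G(2))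
  have "(\<integral>x. (\<Sum>k<m. A i k * x k) * F (Y x) \<partial>?M) = (\<Sum>k<m. A i k * (\<integral>x. x k * F (Y x) \<partial>?M))"
    unfolding expand using int by (subst Bochner_Integration.integral_sum) auto
  also have "\<dots> = (\<Sum>k<m. A i k * (\<integral>x. D k x \<partial>?M))"
    using std_normal_vector_integration_by_parts[OF FY F(2) partials D_lip D_bound] by simp
  also have "\<dots> = (\<Sum>k<m. A i k * (\<Sum>j<n. (s * A j k) * (\<integral>x. G j (Y x) \<partial>?M)))"
    unfolding D_def using intG by (subst Bochner_Integration.integral_sum) auto
  also have "\<dots> = (\<Sum>j<n. \<Sum>k<m. s * ((A i k * A j k) * (\<integral>x. G j (Y x) \<partial>?M)))"
    unfolding sum_distrib_left by (subst sum.swap) (simp add: mult_ac)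
  also have "\<dots> = s * (\<Sum>j<n. (\<Sum>k<m. A i k * A j k) * (\<integral>x. G j (Y x) \<partial>?M))"
    by (simp add: sum_distrib_left sum_distrib_right)
  finally show "(\<integral>x. (\<Sum>k<m. A i k * x k) * F (Y x) \<partial>?M)
      = s * (\<Sum>j<n. (\<Sum>k<m. A i k * A j k) * (\<integral>x. G j (Y x) \<partial>?M))" .
qed

text \<open>By the mean value theorem each difference quotient is a derivative at some intermediate
  parameter, so \<open>w\<close> dominates it. The limit is taken along sequences to apply dominated
  convergence.\<close>

lemma has_real_derivative_integral:
  fixes f f' :: "real \<Rightarrow> 'a \<Rightarrow> real"
  assumes int: "\<And>t. integrable M (f t)"
    and deriv: "\<And>t x. ((\<lambda>t. f t x) has_real_derivative f' t x) (at t)"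
    and meas: "f' t \<in> borel_measurable M"
    and bound: "\<And>t x. \<bar>f' t x\<bar> \<le> w x" and w: "integrable M w"
  shows "((\<lambda>t. \<integral>x. f t x \<partial>M) has_real_derivative (\<integral>x. f' t x \<partial>M)) (at t)"
  unfolding has_field_derivative_iff tendsto_at_iff_sequentially
proof (intro allI impI)
  fix X :: "nat \<Rightarrow> real"
  assume X: "\<forall>i. X i \<in> UNIV - {t}" "X \<longlonglongrightarrow> t"
  have "(\<lambda>i. \<integral>x. (f (X i) x - f t x) / (X i - t) \<partial>M) \<longlonglongrightarrow> (\<integral>x. f' t x \<partial>M)"
  proof (rule integral_dominated_convergence[where w = w])
    show "AE x in M. (\<lambda>i. (f (X i) x - f t x) / (X i - t)) \<longlonglongrightarrow> f' t x"
    proof (rule AE_I2)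
      fix x
      have "((\<lambda>s. (f s x - f t x) / (s - t)) \<longlongrightarrow> f' t x) (at t)"
        using deriv[of x t] by (simp add: has_field_derivative_iff)
      then show "(\<lambda>i. (f (X i) x - f t x) / (X i - t)) \<longlonglongrightarrow> f' t x"
        unfolding tendsto_at_iff_sequentially using X by (auto simp: comp_def)
    qed
    show "AE x in M. norm ((f (X i) x - f t x) / (X i - t)) \<le> w x" for i
    proof (rule AE_I2)
      fix x
      obtain \<xi> where "f (X i) x - f t x = f' \<xi> x * (X i - t)"
        using mvt_any_order[of "\<lambda>t. f t x" "\<lambda>t. f' t x" "X i" t, OF deriv] by blast
      then show "norm ((f (X i) x - f t x) / (X i - t)) \<le> w x"
        using bound[of \<xi> x] X(1)[rule_format, of i] by (simp add: abs_mult)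
    qed
  qed (use int meas w in \<open>auto intro: borel_measurable_integrable\<close>)
  then show "((\<lambda>s. ((\<integral>x. f s x \<partial>M) - (\<integral>x. f t x \<partial>M)) / (s - t)) \<circ> X) \<longlonglongrightarrow> (\<integral>x. f' t x \<partial>M)"
    using int by (simp add: comp_def)
qed

section \<open>Interpolation between the spins and the normal vector\<close>

lemma integrable_cw_mean:
  fixes f :: "(nat \<Rightarrow> real) \<Rightarrow> 'a \<Rightarrow> real"
  assumes "\<And>\<sigma>. \<sigma> \<in> spin_configs n \<Longrightarrow> integrable M (f \<sigma>)"
  shows "integrable M (\<lambda>x. cw_mean \<beta> n (\<lambda>\<sigma>. f \<sigma> x))"
  unfolding cw_mean_def using assms by (intro Bochner_Integration.integrable_sum integrable_mult_right) auto

lemma integral_cw_mean: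
  fixes f :: "(nat \<Rightarrow> real) \<Rightarrow> 'a \<Rightarrow> real"
  assumes "\<And>\<sigma>. \<sigma> \<in> spin_configs n \<Longrightarrow> integrable M (f \<sigma>)"
  shows "(\<integral>x. cw_mean \<beta> n (\<lambda>\<sigma>. f \<sigma> x) \<partial>M) = cw_mean \<beta> n (\<lambda>\<sigma>. \<integral>x. f \<sigma> x \<partial>M)"
  unfolding cw_mean_def using assms by (subst Bochner_Integration.integral_sum) auto

lemma has_real_derivative_cw_mean:
  assumes "\<And>\<sigma>. ((\<lambda>t. f t \<sigma>) has_real_derivative f' \<sigma>) (at t)"
  shows "((\<lambda>t. cw_mean \<beta> n (f t)) has_real_derivative cw_mean \<beta> n f') (at t)"
  unfolding cw_mean_def by (intro DERIV_sum DERIV_cmult assms)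

text \<open>The two averages are taken in opposite orders. For a fixed configuration, Gaussian
  integration by parts turns the integrated derivative along the rotation into
  \<open>- sin t\<close> times the integral of a discrepancy \<open>R\<close>. For a fixed Gaussian
  point, the spin average of \<open>R\<close> is small by the spin equations with test function
  \<open>H1 i\<close>, \<open>\<epsilon> = cos t / sqrt n\<close> and the Gaussian part as shift.
  Finite sums over configurations commute with integrals, which joins the two.\<close>

lemma gaussian_comparison:
  fixes H :: "(nat \<Rightarrow> real) \<Rightarrow> real" and A :: "nat \<Rightarrow> nat \<Rightarrow> real"
  assumes \<beta>: "\<beta> < 1" and n: "n \<ge> 1"
    and H: "depends_on_first n H" "has_partials n H H1"
    and H1: "\<And>i. i < n \<Longrightarrow> depends_on_first n (H1 i)" "\<And>i. i < n \<Longrightarrow> has_partials n (H1 i) (H2 i)"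
      "\<And>i x. i < n \<Longrightarrow> \<bar>H1 i x\<bar> \<le> a"
    and H2: "\<And>i j x. i < n \<Longrightarrow> j < n \<Longrightarrow> \<bar>H2 i j x\<bar> \<le> b"
      "\<And>i j. i < n \<Longrightarrow> j < n \<Longrightarrow> l1_lipschitz n c (H2 i j)"
    and c: "c \<ge> 0"
    and A: "\<And>i j. i < n \<Longrightarrow> j < n \<Longrightarrow> cw_covariance \<beta> n i j = (\<Sum>k<m. A i k * A j k)"
  shows "\<bar>cw_mean \<beta> n (\<lambda>\<sigma>. H (\<lambda>i. \<sigma> i / sqrt (real n)))
      - (\<integral>x. H (\<lambda>i. \<Sum>k<m. A i k * x k) \<partial>std_normal_vector m)\<bar>
    \<le> pi / 2 * ((1 + \<bar>\<beta>\<bar> / (1 - \<beta>)) * cw_const \<beta>)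
        * ((a + c) / sqrt (real n) + b / real n)"
proof -
  let ?M = "std_normal_vector m"
  interpret prob_space ?M by (rule std_normal_vector_prob)
  define r where "r = sqrt (real n)"
  have n0: "real n > 0" "n > 0" using n by auto
  have r: "r > 0" "r * r = real n" using n0 by (auto simp: r_def)
  have ab: "a \<ge> 0" "b \<ge> 0"
    using H1(3)[OF n0(2), of "\<lambda>_. 0"] H2(1)[OF n0(2) n0(2), of "\<lambda>_. 0"] by linarith+
  have H1_lip: "l1_lipschitz n b (H1 i)" if "i < n" for i
    by (rule l1_lipschitz_if_partials_bounded[OF H1(1)[OF that] H1(2)[OF that]]) (rule H2(1)[OF that])
  have H_lip: "l1_lipschitz n a H"
    by (rule l1_lipschitz_if_partials_bounded[OF H]) (rule H1(3))
  define Z where "Z x i = (\<Sum>k<m. A i k * x k)" for x :: "nat \<Rightarrow> real" and i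
  define Y where "Y t \<sigma> x = (\<lambda>i. cos t / r * \<sigma> i + sin t * Z x i)" for t and \<sigma> x :: "nat \<Rightarrow> real"
  define D where "D t \<sigma> x = (\<Sum>i<n. H1 i (Y t \<sigma> x) * (- sin t / r * \<sigma> i + cos t * Z x i))" for t \<sigma> x
  \<comment> \<open>The defect in the Stein equation of the spins at angle \<open>t\<close>; in the
    derivative of the path its covariance term arises from the Gaussian side.\<close>
  define R where "R t \<sigma> x = (\<Sum>i<n. \<sigma> i / r * H1 i (Y t \<sigma> x)
      - cos t * (\<Sum>j<n. cw_covariance \<beta> n i j * H2 i j (Y t \<sigma> x)))" for t \<sigma> x
  define \<eta> where "\<eta> = (1 + \<bar>\<beta>\<bar> / (1 - \<beta>)) * (cw_const \<beta> * (a + c + b / r) / real n)"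
  have int_H1: "integrable ?M (\<lambda>x. H1 i (Y t \<sigma> x))" if "i < n" for i t \<sigma>
    unfolding Y_def Z_def by (rule MVN_integration_by_parts(1)[OF H1_lip H1(3) H1(2) H2(2) H2(1) ab(2) c]) (use that in auto)
  have int_H2: "integrable ?M (\<lambda>x. H2 i j (Y t \<sigma> x))" if "i < n" "j < n" for i j t \<sigma>
    unfolding Y_def Z_def by (rule MVN_integration_by_parts(2)[OF H1_lip H1(3) H1(2) H2(2) H2(1) ab(2) c]) (use that in auto)
  have int_ZH1: "integrable ?M (\<lambda>x. Z x i * H1 i (Y t \<sigma> x))" if "i < n" for i t \<sigma>
    unfolding Y_def Z_def by (rule MVN_integration_by_parts(3)[OF H1_lip H1(3) H1(2) H2(2) H2(1) ab(2) c]) (use that in auto)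
  have ibp: "(\<integral>x. Z x i * H1 i (Y t \<sigma> x) \<partial>?M)
      = sin t * (\<Sum>j<n. cw_covariance \<beta> n i j * (\<integral>x. H2 i j (Y t \<sigma> x) \<partial>?M))" if "i < n" for i t \<sigma>
  proof -
    have "(\<integral>x. Z x i * H1 i (Y t \<sigma> x) \<partial>?M)
      = sin t * (\<Sum>j<n. (\<Sum>k<m. A i k * A j k) * (\<integral>x. H2 i j (Y t \<sigma> x) \<partial>?M))"
      unfolding Y_def Z_def by (rule MVN_integration_by_parts(4)[OF H1_lip H1(3) H1(2) H2(2) H2(1) ab(2) c]) (use that in auto)
    then show ?thesis using A[OF that] by simp
  qed
  have int_Z: "integrable ?M (\<lambda>x. Z x i)" for i
    unfolding Z_def
    by (intro Bochner_Integration.integrable_sum integrable_mult_right integrable_std_normal_vector_component) auto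
  \<comment> \<open>\<open>H\<close> is Lipschitz but possibly unbounded, hence a majorant of linear
    growth in \<open>Z\<close>.\<close>
  have int_H: "integrable ?M (\<lambda>x. H (Y t \<sigma> x))" for t \<sigma>
  proof (rule Bochner_Integration.integrable_bound)
    show "integrable ?M (\<lambda>x. \<bar>H (\<lambda>_. 0)\<bar> + a * (\<Sum>i<n. \<bar>cos t / r * \<sigma> i + sin t * Z x i\<bar>))"
      using int_Z by (intro Bochner_Integration.integrable_add integrable_const integrable_mult_right
        Bochner_Integration.integrable_sum integrable_abs)
    have "(\<lambda>x. H (Y t \<sigma> x)) \<in> borel_measurable (borel_Rn m)"
      unfolding Y_def Z_def by (rule l1_lipschitz_measurable[OF l1_lipschitz_affine[OF H_lip ab(1)]])
    then show "(\<lambda>x. H (Y t \<sigma> x)) \<in> borel_measurable ?M"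
      by (simp add: measurable_cong_sets[OF sets_std_normal_vector])
    show "AE x in ?M. norm (H (Y t \<sigma> x)) \<le> norm (\<bar>H (\<lambda>_. 0)\<bar> + a * (\<Sum>i<n. \<bar>cos t / r * \<sigma> i + sin t * Z x i\<bar>))"
    proof (rule AE_I2)
      fix x
      have "\<bar>H (Y t \<sigma> x) - H (\<lambda>_. 0)\<bar> \<le> a * (\<Sum>i<n. \<bar>cos t / r * \<sigma> i + sin t * Z x i\<bar>)"
        using l1_lipschitzD[OF H_lip, of "Y t \<sigma> x" "\<lambda>_. 0"] by (simp add: l1_dist_def Y_def)
      then show "norm (H (Y t \<sigma> x)) \<le> norm (\<bar>H (\<lambda>_. 0)\<bar> + a * (\<Sum>i<n. \<bar>cos t / r * \<sigma> i + sin t * Z x i\<bar>))"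
        unfolding real_norm_def by linarith
    qed
  qed
  have D_expand: "D t \<sigma> x = (\<Sum>i<n. - sin t / r * \<sigma> i * H1 i (Y t \<sigma> x) + cos t * (Z x i * H1 i (Y t \<sigma> x)))" for t \<sigma> x
    unfolding D_def by (simp add: algebra_simps)
  have int_D: "integrable ?M (D t \<sigma>)" for t \<sigma>
    unfolding D_expand[abs_def] using int_H1 int_ZH1
    by (intro Bochner_Integration.integrable_sum Bochner_Integration.integrable_add integrable_mult_right) auto
  have int_R: "integrable ?M (R t \<sigma>)" for t \<sigma>
    unfolding R_def[abs_def] using int_H1 int_H2
    by (intro Bochner_Integration.integrable_sum Bochner_Integration.integrable_diff integrable_mult_right) auto
  have D_R: "(\<integral>x. D t \<sigma> x \<partial>?M) = - sin t * (\<integral>x. R t \<sigma> x \<partial>?M)" for t \<sigma>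
  proof -
    have "(\<integral>x. D t \<sigma> x \<partial>?M) = (\<Sum>i<n. - sin t / r * \<sigma> i * (\<integral>x. H1 i (Y t \<sigma> x) \<partial>?M)
        + cos t * (\<integral>x. Z x i * H1 i (Y t \<sigma> x) \<partial>?M))"
      unfolding D_expand using int_H1 int_ZH1 by (subst Bochner_Integration.integral_sum) auto
    also have "\<dots> = - sin t * (\<Sum>i<n. \<sigma> i / r * (\<integral>x. H1 i (Y t \<sigma> x) \<partial>?M)
        - cos t * (\<Sum>j<n. cw_covariance \<beta> n i j * (\<integral>x. H2 i j (Y t \<sigma> x) \<partial>?M)))"
      unfolding sum_distrib_left[of "- sin t"] by (intro sum.cong) (auto simp: ibp right_diff_distrib mult_ac)
    also have "(\<Sum>i<n. \<sigma> i / r * (\<integral>x. H1 i (Y t \<sigma> x) \<partial>?M)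
        - cos t * (\<Sum>j<n. cw_covariance \<beta> n i j * (\<integral>x. H2 i j (Y t \<sigma> x) \<partial>?M))) = (\<integral>x. R t \<sigma> x \<partial>?M)"
    proof -
      have sum: "integrable ?M (\<lambda>x. \<Sum>j<n. cw_covariance \<beta> n i j * H2 i j (Y t \<sigma> x))"
        "(\<integral>x. (\<Sum>j<n. cw_covariance \<beta> n i j * H2 i j (Y t \<sigma> x)) \<partial>?M)
          = (\<Sum>j<n. cw_covariance \<beta> n i j * (\<integral>x. H2 i j (Y t \<sigma> x) \<partial>?M))" if "i < n" for i
        using int_H2[OF that]
        by (auto intro!: Bochner_Integration.integrable_sum simp: Bochner_Integration.integral_sum)
      define T where "T i x = \<sigma> i / r * H1 i (Y t \<sigma> x)
          - cos t * (\<Sum>j<n. cw_covariance \<beta> n i j * H2 i j (Y t \<sigma> x))" for i x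
      have T: "integrable ?M (T i)" "(\<integral>x. T i x \<partial>?M) = \<sigma> i / r * (\<integral>x. H1 i (Y t \<sigma> x) \<partial>?M)
            - cos t * (\<Sum>j<n. cw_covariance \<beta> n i j * (\<integral>x. H2 i j (Y t \<sigma> x) \<partial>?M))" if "i < n" for i
        using int_H1[OF that] sum[OF that] unfolding T_def[abs_def]
        by (auto intro!: Bochner_Integration.integrable_diff simp del: times_divide_eq_left)
      have "(\<integral>x. R t \<sigma> x \<partial>?M) = (\<Sum>i<n. \<integral>x. T i x \<partial>?M)"
        unfolding R_def T_def[symmetric] using T(1) by (intro Bochner_Integration.integral_sum) auto
      then show ?thesis using T(2) by simp
    qed
    finally show ?thesis .
  qed
  define B where "B = (1 + \<bar>\<beta>\<bar> / (1 - \<beta>)) * cw_const \<beta> * ((a + c) / r + b / real n)"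
  have R_bound: "\<bar>cw_mean \<beta> n (\<lambda>\<sigma>. R t \<sigma> x)\<bar> \<le> B" for t x
  proof -
    have R_expand: "R t \<sigma> x = (\<Sum>i<n. 1 / r * (\<sigma> i * H1 i (Y t \<sigma> x))
        - cos t * (\<Sum>j<n. cw_covariance \<beta> n i j * H2 i j (Y t \<sigma> x)))" for \<sigma>
      by (simp add: R_def)
    have eps: "\<bar>cos t / r\<bar> \<le> 1 / sqrt (real n)"
      unfolding r_def[symmetric] using r by (simp add: abs_divide divide_right_mono)
    have site: "\<bar>cw_mean \<beta> n (\<lambda>\<sigma>. \<sigma> i * H1 i (Y t \<sigma> x))
        - cos t / r * real n * (\<Sum>j<n. cw_covariance \<beta> n i j * cw_mean \<beta> n (\<lambda>\<sigma>. H2 i j (Y t \<sigma> x)))\<bar> \<le> \<eta>"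
      if "i < n" for i
      unfolding \<eta>_def Y_def r_def
      by (rule cw_mean_spin_stein[OF \<beta> H1(3)[OF that] H1(2)[OF that] H2(1)[OF that] H2(2)[OF that] eps[unfolded r_def] c that])
    have "cw_mean \<beta> n (\<lambda>\<sigma>. R t \<sigma> x) = (\<Sum>i<n. 1 / r * cw_mean \<beta> n (\<lambda>\<sigma>. \<sigma> i * H1 i (Y t \<sigma> x))
        - cos t * (\<Sum>j<n. cw_covariance \<beta> n i j * cw_mean \<beta> n (\<lambda>\<sigma>. H2 i j (Y t \<sigma> x))))"
      unfolding R_expand by (simp only: cw_mean_sum cw_mean_diff cw_mean_cmult)
    \<comment> \<open>As \<open>r * r = real n\<close>, \<open>cos t\<close> equals
      \<open>1 / r * (cos t / r * real n)\<close>, so a factor \<open>1 / r\<close> comes out of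
      each coordinate.\<close>
    also have "\<dots> = (\<Sum>i<n. 1 / r * (cw_mean \<beta> n (\<lambda>\<sigma>. \<sigma> i * H1 i (Y t \<sigma> x))
        - cos t / r * real n * (\<Sum>j<n. cw_covariance \<beta> n i j * cw_mean \<beta> n (\<lambda>\<sigma>. H2 i j (Y t \<sigma> x)))))"
      using r(1) by (intro sum.cong) (auto simp: r(2)[symmetric] field_simps)
    also have "\<bar>\<dots>\<bar> \<le> (\<Sum>i<n. 1 / r * \<eta>)"
      using site r(1) by (intro order_trans[OF sum_abs] sum_mono) (auto simp: abs_mult divide_right_mono)
    also have "\<dots> = (1 + \<bar>\<beta>\<bar> / (1 - \<beta>)) * cw_const \<beta> * (1 / r * (a + c + b / r))"
      using n0 by (simp add: \<eta>_def)
    also have "1 / r * (a + c + b / r) = (a + c) / r + b / real n"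
      using r(1) unfolding r(2)[symmetric] by (simp add: field_simps)
    finally show ?thesis unfolding B_def .
  qed
  define \<Phi> where "\<Phi> t = (\<integral>x. cw_mean \<beta> n (\<lambda>\<sigma>. H (Y t \<sigma> x)) \<partial>?M)" for t
  \<comment> \<open>A majorant uniform in the angle and over all configurations, since the spins
    have modulus 1.\<close>
  define W where "W x = (\<Sum>i<n. a * (1 / r + \<bar>Z x i\<bar>))" for x
  have deriv: "(\<Phi> has_real_derivative (\<integral>x. cw_mean \<beta> n (\<lambda>\<sigma>. D t \<sigma> x) \<partial>?M)) (at t)" for t
    unfolding \<Phi>_def
  proof (rule has_real_derivative_integral[where w = W])
    show "integrable ?M (\<lambda>x. cw_mean \<beta> n (\<lambda>\<sigma>. H (Y t \<sigma> x)))" for t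
      by (intro integrable_cw_mean int_H)
    show "(\<lambda>x. cw_mean \<beta> n (\<lambda>\<sigma>. D t \<sigma> x)) \<in> borel_measurable ?M"
      by (intro borel_measurable_integrable integrable_cw_mean int_D)
    show "integrable ?M W"
      unfolding W_def using int_Z by (intro Bochner_Integration.integrable_sum integrable_mult_right
        Bochner_Integration.integrable_add integrable_const integrable_abs)
    fix t x
    show "((\<lambda>t. cw_mean \<beta> n (\<lambda>\<sigma>. H (Y t \<sigma> x))) has_real_derivative cw_mean \<beta> n (\<lambda>\<sigma>. D t \<sigma> x)) (at t)"
    proof (rule has_real_derivative_cw_mean)
      fix \<sigma>
      show "((\<lambda>t. H (Y t \<sigma> x)) has_real_derivative D t \<sigma> x) (at t)"
        unfolding D_def
      proof (rule has_real_derivative_along_curve[OF H H1_lip ab(2)])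
        show "((\<lambda>s. Y s \<sigma> x i) has_real_derivative - sin t / r * \<sigma> i + cos t * Z x i) (at t)" for i
          unfolding Y_def using r(1) by (auto intro!: derivative_eq_intros)
      qed
    qed
    show "\<bar>cw_mean \<beta> n (\<lambda>\<sigma>. D t \<sigma> x)\<bar> \<le> W x"
    proof -
      have "\<bar>cw_mean \<beta> n (\<lambda>\<sigma>. D t \<sigma> x)\<bar> \<le> cw_mean \<beta> n (\<lambda>_. W x)"
      proof (rule cw_mean_abs_le)
        fix \<sigma> assume \<sigma>: "\<sigma> \<in> spin_configs n"
        show "\<bar>D t \<sigma> x\<bar> \<le> W x"
          unfolding D_def W_def
        proof (intro order_trans[OF sum_abs] sum_mono)
          fix i assume "i \<in> {..<n}"
          then have i: "i < n" by simp
          have "\<bar>- sin t / r * \<sigma> i\<bar> \<le> 1 / r"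
            using spin_cases[OF \<sigma> i] r(1) by (auto simp: abs_divide divide_right_mono)
          moreover have "\<bar>cos t * Z x i\<bar> \<le> \<bar>Z x i\<bar>"
            using mult_right_mono[OF abs_cos_le_one[of t], of "\<bar>Z x i\<bar>"] by (simp add: abs_mult)
          ultimately have "\<bar>- sin t / r * \<sigma> i + cos t * Z x i\<bar> \<le> 1 / r + \<bar>Z x i\<bar>" by linarith
          then show "\<bar>H1 i (Y t \<sigma> x) * (- sin t / r * \<sigma> i + cos t * Z x i)\<bar> \<le> a * (1 / r + \<bar>Z x i\<bar>)"
            unfolding abs_mult using H1(3)[OF i] ab(1) by (intro mult_mono) auto
        qed
      qed
      then show ?thesis by simp
    qed
  qed
  have deriv_bound: "\<bar>\<integral>x. cw_mean \<beta> n (\<lambda>\<sigma>. D t \<sigma> x) \<partial>?M\<bar> \<le> B" for t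
  proof -
    have "(\<integral>x. cw_mean \<beta> n (\<lambda>\<sigma>. D t \<sigma> x) \<partial>?M) = - sin t * (\<integral>x. cw_mean \<beta> n (\<lambda>\<sigma>. R t \<sigma> x) \<partial>?M)"
      using int_D int_R by (simp only: integral_cw_mean D_R cw_mean_cmult)
    moreover have "\<bar>\<integral>x. cw_mean \<beta> n (\<lambda>\<sigma>. R t \<sigma> x) \<partial>?M\<bar> \<le> (\<integral>x. B \<partial>?M)"
      using R_bound int_R
      by (intro order_trans[OF integral_abs_bound] integral_mono integrable_abs integrable_cw_mean integrable_const) auto
    then have "\<bar>\<integral>x. cw_mean \<beta> n (\<lambda>\<sigma>. R t \<sigma> x) \<partial>?M\<bar> \<le> B" by (simp add: prob_space)
    ultimately show ?thesis
      using mult_mono[OF abs_sin_le_one[of t], of "\<bar>\<integral>x. cw_mean \<beta> n (\<lambda>\<sigma>. R t \<sigma> x) \<partial>?M\<bar>" B]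
      by (simp add: abs_mult)
  qed
  \<comment> \<open>Angle 0 gives the spins, \<open>pi / 2\<close> the normal vector; the length of
    this interval is the source of the factor \<open>pi / 2\<close>.\<close>
  obtain \<xi> where \<xi>: "\<Phi> (pi / 2) - \<Phi> 0 = (\<integral>x. cw_mean \<beta> n (\<lambda>\<sigma>. D \<xi> \<sigma> x) \<partial>?M) * (pi / 2 - 0)"
    using mvt_any_order[OF deriv, of "pi / 2" 0] by blast
  have "\<bar>\<Phi> (pi / 2) - \<Phi> 0\<bar> = \<bar>\<integral>x. cw_mean \<beta> n (\<lambda>\<sigma>. D \<xi> \<sigma> x) \<partial>?M\<bar> * (pi / 2)"
    unfolding \<xi> by (simp add: abs_mult)
  also have "\<dots> \<le> B * (pi / 2)"
    using deriv_bound by (intro mult_right_mono) auto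
  finally have "\<bar>\<Phi> 0 - \<Phi> (pi / 2)\<bar> \<le> B * (pi / 2)"
    by (simp only: abs_minus_commute)
  moreover have "\<Phi> 0 = cw_mean \<beta> n (\<lambda>\<sigma>. H (\<lambda>i. \<sigma> i / sqrt (real n)))"
    unfolding \<Phi>_def Y_def r_def by (simp add: prob_space)
  moreover have "\<Phi> (pi / 2) = (\<integral>x. H (\<lambda>i. \<Sum>k<m. A i k * x k) \<partial>?M)"
    unfolding \<Phi>_def Y_def Z_def by simp
  ultimately show ?thesis by (simp add: B_def r_def mult_ac)
qed

section \<open>From the partial derivatives of \<open>h\<close> to the comparison\<close>

lemma iter_partial_has_partials:
  assumes "times_partially_differentiable k n h" "length is < k" "set is \<subseteq> {..<n}"
  shows "has_partials n (\<lambda>x. iter_partial is h (restrict x {..<n}))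
    (\<lambda>i x. iter_partial (i # is) h (restrict x {..<n}))"
  unfolding has_partials_def
proof (intro allI impI)
  fix x :: "nat \<Rightarrow> real" and i assume i: "i < n"
  define y where "y = restrict x {..<n}"
  have y: "y \<in> Rn n" "y i = x i" using i by (auto simp: y_def)
  have upd: "restrict (x(i := s)) {..<n} = y(i := s)" for s using i by (auto simp: y_def restrict_def)
  have "(\<lambda>s. iter_partial is h (y(i := s))) differentiable (at (y i))"
    using assms y i unfolding times_partially_differentiable_def by blast
  then have "((\<lambda>s. iter_partial is h (y(i := s))) has_real_derivative iter_partial (i # is) h y) (at (y i))"
    using DERIV_deriv_iff_real_differentiable by (simp add: iter_partial_def partial_deriv_def)
  then show "((\<lambda>s. iter_partial is h (restrict (x(i := s)) {..<n})) has_real_derivative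
      iter_partial (i # is) h (restrict x {..<n})) (at (x i))"
    unfolding upd y_def[symmetric] y(2) .
qed

text \<open>The seminorm runs over sorted index lists; symmetry of mixed derivatives, part of the
  differentiability assumption, reduces any list to its sorted version. Finiteness makes
  \<open>enn2real\<close> faithful.\<close>

lemma iter_partial_le_seminorm:
  assumes "times_partially_differentiable K n h" "length is = k" "k \<le> K" "set is \<subseteq> {..<n}"
    "x \<in> Rn n" "partial_seminorm n k h < top"
  shows "\<bar>iter_partial is h x\<bar> \<le> enn2real (partial_seminorm n k h)"
proof -
  have "iter_partial is h x = iter_partial (sort is) h x"
    using assms unfolding times_partially_differentiable_def by (metis mset_sort)
  moreover have "ennreal \<bar>iter_partial (sort is) h x\<bar> \<le> partial_seminorm n k h"
    unfolding partial_seminorm_def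
    by (rule SUP_upper2[of "sort is"], use assms in simp, rule SUP_upper2[of x], use assms in auto)
  ultimately show ?thesis
    using enn2real_mono[OF _ assms(6)] by fastforce
qed

theorem theorem4p9:
  fixes \<beta> :: real
  assumes "\<beta> < 1"
  shows "\<exists>C::real. C > 0 \<and>
    (\<forall>n::nat. n \<ge> 1 \<longrightarrow>
      (\<forall>(Z_law :: (nat \<Rightarrow> real) measure) (h :: (nat \<Rightarrow> real) \<Rightarrow> real).
        is_MVN n (cw_covariance \<beta> n) Z_law \<longrightarrow>
        times_partially_differentiable 3 n h \<longrightarrow>
        ennreal \<bar>(\<integral>\<sigma>. h (rescale n \<sigma>) \<partial>curie_weiss \<beta> n) - (\<integral>z. h z \<partial>Z_law)\<bar>
          \<le> ennreal C * ((partial_seminorm n 1 h + partial_seminorm n 3 h) / ennreal (sqrt (real n))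
              + partial_seminorm n 2 h / ennreal (real n))))"
proof -
  \<comment> \<open>The length of the rotation, times the cost of solving for the total spin, times
    the cost of linearising one spin.\<close>
  define C where "C = pi / 2 * ((1 + \<bar>\<beta>\<bar> / (1 - \<beta>)) * cw_const \<beta>)"
  have C: "C > 0"
    unfolding C_def using assms cw_const_pos[OF assms]
    by (intro mult_pos_pos add_pos_nonneg divide_nonneg_pos) auto
  show ?thesis
  proof (intro exI[of _ C] conjI C allI impI)
    fix n :: nat and Z_law :: "(nat \<Rightarrow> real) measure" and h :: "(nat \<Rightarrow> real) \<Rightarrow> real"
    assume n: "n \<ge> 1" and Z: "is_MVN n (cw_covariance \<beta> n) Z_law"
      and h: "times_partially_differentiable 3 n h"
    let ?N = "\<lambda>k. partial_seminorm n k h"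
    have n0: "real n > 0" "ennreal (real n) \<noteq> 0" "ennreal (sqrt (real n)) \<noteq> 0" using n by auto
    show "ennreal \<bar>(\<integral>\<sigma>. h (rescale n \<sigma>) \<partial>curie_weiss \<beta> n) - (\<integral>z. h z \<partial>Z_law)\<bar>
          \<le> ennreal C * ((?N 1 + ?N 3) / ennreal (sqrt (real n)) + ?N 2 / ennreal (real n))"
    proof (cases "?N 1 < top \<and> ?N 2 < top \<and> ?N 3 < top")
      \<comment> \<open>An infinite seminorm makes the bracket infinite; \<open>C > 0\<close> keeps
        the product infinite, as \<open>0 * top = 0\<close> in \<open>ennreal\<close>.\<close>
      case False
      then have "(?N 1 + ?N 3) / ennreal (sqrt (real n)) + ?N 2 / ennreal (real n) = top"
        by (auto simp: not_less top_unique ennreal_top_divide)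
      then show ?thesis using C by (simp only: ennreal_mult_top) simp
    next
      case True
      define a b c where "a = enn2real (?N 1)" and "b = enn2real (?N 2)" and "c = enn2real (?N 3)"
      have N: "?N 1 = ennreal a" "?N 2 = ennreal b" "?N 3 = ennreal c"
        using True by (auto simp: a_def b_def c_def)
      have nonneg: "a \<ge> 0" "b \<ge> 0" "c \<ge> 0" by (auto simp: a_def b_def c_def)
      \<comment> \<open>Restriction turns functions controlled on \<open>Rn n\<close> into functions
        of arbitrary points that ignore the coordinates from \<open>n\<close> on.\<close>
      define E where "E is x = iter_partial is h (restrict x {..<n})" for "is" x
      have E_dep: "depends_on_first n (E is)" for "is"
        unfolding depends_on_first_def E_def
        by (intro allI impI arg_cong[of _ _ "iter_partial is h"]) (auto simp: restrict_def)
      have E_partials: "has_partials n (E is) (\<lambda>i. E (i # is))" if "length is < 3" "set is \<subseteq> {..<n}" for "is"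
        using iter_partial_has_partials[OF h that] unfolding E_def .
      have E_bound: "\<bar>E is x\<bar> \<le> enn2real (?N k)" if "length is = k" "k \<in> {1, 2, 3}" "set is \<subseteq> {..<n}" for "is" x k
        unfolding E_def using that True by (intro iter_partial_le_seminorm[OF h]) auto
      obtain m A where A: "\<forall>i<n. \<forall>j<n. cw_covariance \<beta> n i j = (\<Sum>k<m. A i k * A j k)"
        and Z_law: "Z_law = distr (std_normal_vector m) (borel_Rn n) (\<lambda>x. \<lambda>i\<in>{..<n}. \<Sum>k<m. A i k * x k)"
        using Z unfolding is_MVN_def by blast
      \<comment> \<open>The list \<open>[j, i]\<close> differentiates in \<open>i\<close> first,
        matching \<open>H2 i j\<close> as the \<open>j\<close>-th derivative of \<open>H1 i\<close>.
        The bound on third derivatives becomes the Lipschitz constant.\<close>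
      have H2_lip: "l1_lipschitz n c (E [j, i])" if "i < n" "j < n" for i j
        by (rule l1_lipschitz_if_partials_bounded[OF E_dep E_partials])
          (use that in \<open>auto simp: c_def intro!: E_bound\<close>)
      have "\<bar>cw_mean \<beta> n (\<lambda>\<sigma>. E [] (\<lambda>i. \<sigma> i / sqrt (real n)))
          - (\<integral>x. E [] (\<lambda>i. \<Sum>k<m. A i k * x k) \<partial>std_normal_vector m)\<bar>
          \<le> C * ((a + c) / sqrt (real n) + b / real n)"
        unfolding C_def
      proof (rule gaussian_comparison[OF assms n, where ?H1.0 = "\<lambda>i. E [i]" and ?H2.0 = "\<lambda>i j. E [j, i]"])
        show "has_partials n (E []) (\<lambda>i. E [i])" by (rule E_partials) auto
        show "has_partials n (E [i]) (\<lambda>j. E [j, i])" if "i < n" for i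
          by (rule E_partials) (use that in auto)
        show "\<bar>E [i] x\<bar> \<le> a" if "i < n" for i x
          unfolding a_def by (rule E_bound) (use that in auto)
        show "\<bar>E [j, i] x\<bar> \<le> b" if "i < n" "j < n" for i j x
          unfolding b_def by (rule E_bound) (use that in auto)
      qed (use A E_dep H2_lip nonneg in auto)
      moreover have "(\<integral>\<sigma>. h (rescale n \<sigma>) \<partial>curie_weiss \<beta> n) = cw_mean \<beta> n (\<lambda>\<sigma>. E [] (\<lambda>i. \<sigma> i / sqrt (real n)))"
        by (simp add: integral_curie_weiss E_def iter_partial_def rescale_def)
      moreover have "(\<integral>z. h z \<partial>Z_law) = (\<integral>x. E [] (\<lambda>i. \<Sum>k<m. A i k * x k) \<partial>std_normal_vector m)"
      proof -
        \<comment> \<open>The Lipschitz bound also yields the measurability of \<open>h\<close> on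
          \<open>Rn n\<close>, which pulling the integral back along \<open>distr\<close>
          requires.\<close>
        have "l1_lipschitz n a (E [])"
          by (rule l1_lipschitz_if_partials_bounded[OF E_dep E_partials])
            (auto simp: a_def intro!: E_bound)
        then have "E [] \<in> borel_measurable (borel_Rn n)" by (rule l1_lipschitz_measurable)
        moreover have "E [] z = h z" if "z \<in> space (borel_Rn n)" for z
          using that by (simp add: E_def iter_partial_def space_PiM PiE_restrict)
        ultimately have "h \<in> borel_measurable (borel_Rn n)"
          using measurable_cong[of "borel_Rn n" "E []" h borel] by blast
        moreover have "(\<lambda>x. \<lambda>i\<in>{..<n}. \<Sum>k<m. A i k * x k) \<in> measurable (std_normal_vector m) (borel_Rn n)"
        proof (rule measurable_restrict)
          fix i
          show "(\<lambda>x. \<Sum>k<m. A i k * x k) \<in> borel_measurable (std_normal_vector m)"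
            by (intro borel_measurable_sum borel_measurable_times borel_measurable_const
                borel_measurable_integrable integrable_std_normal_vector_component) auto
        qed
        ultimately show ?thesis
          unfolding Z_law by (simp add: integral_distr E_def iter_partial_def)
      qed
      ultimately have "\<bar>(\<integral>\<sigma>. h (rescale n \<sigma>) \<partial>curie_weiss \<beta> n) - (\<integral>z. h z \<partial>Z_law)\<bar>
          \<le> C * ((a + c) / sqrt (real n) + b / real n)" by simp
      then have "ennreal \<bar>(\<integral>\<sigma>. h (rescale n \<sigma>) \<partial>curie_weiss \<beta> n) - (\<integral>z. h z \<partial>Z_law)\<bar>
          \<le> ennreal (C * ((a + c) / sqrt (real n) + b / real n))" by (rule ennreal_leI)
      also have "\<dots> = ennreal C * ((?N 1 + ?N 3) / ennreal (sqrt (real n)) + ?N 2 / ennreal (real n))"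
        unfolding N using C n0(1) nonneg
        by (simp add: ennreal_mult divide_ennreal ennreal_plus[symmetric] del: ennreal_plus)
      finally show ?thesis .
    qed
  qed
qed

end
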